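(* Let $X$ and $Y$ be Banach spaces such that $X^{*}$ is of cotype $q$, where $2\leq q<\infty$. Let $\Omega$ be a compact Hausdorff space. Assume that $S\in\mathcal{L}(\mathcal{C}(\Omega),\mathcal{L}(X,Y))$. Then, for each $p$ with $1\leq p<q'$, there exists an operator $U\in\mathcal{L}(\mathcal{C}_{p}(\Omega,X),Y)$ such that $U^{\#}=S$.
   Context: All Banach spaces are over the same field $\mathbb{K}$ ($\mathbb{R}$ or $\mathbb{C}$); $\mathcal{L}(X,Y)$ is the Banach space of bounded linear operators; $p'$ and $q'$ denote conjugate indices, $1/p+1/p'=1$ with $1/\infty=0$. $\mathcal{C}(\Omega)$ and $\mathcal{C}(\Omega,X)$ are the spaces of continuous $\mathbb{K}$-valued and $X$-valued functions on $\Omega$ with the supremum norm. $\mathcal{C}_p(\Omega,X)$ ($1\le p<\infty$), the Banach space of $p$-continuous $X$-valued functions, consists of all $f\in\mathcal{C}(\Omega,X)$ for which there is a sequence $(x_n)\in\ell_p(X)$ with $f(\Omega)\subset\{\sum_n\alpha_nx_n:(\alpha_n)\in B_{\ell_{p'}}\}$, where $B_{\ell_{p'}}$ is the closed unit ball of $\ell_{p'}$; its norm is $\|f\|_{\mathcal{C}_p(\Omega,X)}=\inf\|(x_n)\|_p$ over all such sequences. It is known that $\mathcal{C}_p(\Omega,X)=\mathcal{C}(\Omega)\hat{\otimes}_{d_p}X$ as Banach spaces via $\varphi x\leftrightarrow\varphi\otimes x$, where $\varphi x$ is the function $\omega\mapsto\varphi(\omega)x$ and $d_p$ is the right Chevet--Saphar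 tensor norm: for $u\in Z\otimes X$, $d_p(u)=\inf\{\|(z_i)\|_{p'}^w\,\|(x_i)\|_p: u=\sum_{i=1}^n z_i\otimes x_i\}$, with $\|(x_i)\|_p=(\sum\|x_i\|^p)^{1/p}$ and $\|(z_i)\|_{r}^w=\sup_{z^*\in B_{Z^*}}(\sum|z^*(z_i)|^{r})^{1/r}$ (usual suprema for the index $\infty$). For $U\in\mathcal{L}(\mathcal{C}_p(\Omega,X),Y)$, the associated operator $U^{\#}\in\mathcal{L}(\mathcal{C}(\Omega),\mathcal{L}(X,Y))$ is $(U^{\#}\varphi)x=U(\varphi x)$. Cotype is the usual Rademacher cotype. *)

theory Defs
  imports "HOL-Analysis.Analysis"
begin

(* Scalar fields: the class contains exactly the isometric copies of the real and the complex
   field, so that a type variable of this class plays the role of "K is R or C". *)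
class rc_field = real_normed_field +
  assumes rc_embedding:
    "\<exists>h :: 'a \<Rightarrow> complex.
       (\<forall>a b. h (a + b) = h a + h b) \<and> (\<forall>a b. h (a * b) = h a * h b) \<and>
       (\<forall>r. h (r *\<^sub>R 1) = complex_of_real r) \<and> (\<forall>a. cmod (h a) = norm a) \<and>
       (range h = \<real> \<or> range h = UNIV)"

instance real :: rc_field
  by standard (rule exI[of _ complex_of_real], auto simp: Reals_def)

instance complex :: rc_field
  by standard (rule exI[of _ "\<lambda>z. z"], auto simp: scaleR_conv_of_real)

(* A normed space over K.  The type class supplies addition, the norm and the scalar
   multiplication by reals; the locale adds a compatible scalar multiplication by K.
   A Banach space over K is such a space on a type of class banach. *)
locale normed_space_over = vector_space scale
  for scale :: "'k::rc_field \<Rightarrow> 'a::real_normed_vector \<Rightarrow> 'a" +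
  assumes scale_of_real: "scale (of_real r) x = r *\<^sub>R x"
    and norm_scale: "norm (scale c x) = norm c * norm x"
begin

lemma bounded_bilinear_scale: "bounded_bilinear scale"
proof
  fix r a b
  show "scale (r *\<^sub>R a) b = r *\<^sub>R scale a b"
    by (metis scale_of_real scale_scale scaleR_conv_of_real)
  show "scale a (r *\<^sub>R b) = r *\<^sub>R scale a b"
    by (metis scale_of_real scale_left_commute)
  show "\<exists>K. \<forall>a b. norm (scale a b) \<le> norm a * norm b * K"
    by (rule exI[of _ 1]) (simp add: norm_scale)
qed (auto simp: scale_left_distrib scale_right_distrib)

end

lemma normed_space_over_field:
  "normed_space_over ((*) :: 'k::rc_field \<Rightarrow> 'k \<Rightarrow> 'k)"
  by unfold_locales (auto simp: algebra_simps norm_mult scaleR_conv_of_real)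

(* L(X,Y): the K-linear members of the type of bounded R-linear maps, with its operator norm. *)
definition operators ::
  "('k::rc_field \<Rightarrow> 'a::real_normed_vector \<Rightarrow> 'a) \<Rightarrow> ('k \<Rightarrow> 'b::real_normed_vector \<Rightarrow> 'b)
    \<Rightarrow> ('a \<Rightarrow>\<^sub>L 'b) set"
  where "operators sa sb = {T. Vector_Spaces.linear sa sb (blinfun_apply T)}"

abbreviation dual :: "('k::rc_field \<Rightarrow> 'a::real_normed_vector \<Rightarrow> 'a) \<Rightarrow> ('a \<Rightarrow>\<^sub>L 'k) set"
  where "dual sa \<equiv> operators sa (*)"

definition scale_blinfun ::
  "('k::rc_field \<Rightarrow> 'b::real_normed_vector \<Rightarrow> 'b) \<Rightarrow> 'k
    \<Rightarrow> ('a::real_normed_vector \<Rightarrow>\<^sub>L 'b) \<Rightarrow> ('a \<Rightarrow>\<^sub>L 'b)"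
  where "scale_blinfun sb c T = Blinfun (\<lambda>x. sb c (blinfun_apply T x))"

definition scale_bcontfun ::
  "('k::rc_field \<Rightarrow> 'a::real_normed_vector \<Rightarrow> 'a) \<Rightarrow> 'k
    \<Rightarrow> ('w::topological_space \<Rightarrow>\<^sub>C 'a) \<Rightarrow> ('w \<Rightarrow>\<^sub>C 'a)"
  where "scale_bcontfun sa c f = Bcontfun (\<lambda>w. sa c (apply_bcontfun f w))"

(* the function \<phi> x : w \<mapsto> \<phi>(w) x *)
definition elem_fun ::
  "('k::rc_field \<Rightarrow> 'a::real_normed_vector \<Rightarrow> 'a)
    \<Rightarrow> ('w::topological_space \<Rightarrow>\<^sub>C 'k) \<Rightarrow> 'a \<Rightarrow> ('w \<Rightarrow>\<^sub>C 'a)"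
  where "elem_fun sa \<phi> x = Bcontfun (\<lambda>w. sa (apply_bcontfun \<phi> w) x)"

(* The next lemmas show that Blinfun and Bcontfun above are applied to legitimate arguments. *)
context normed_space_over
begin

lemma scale_blinfun_apply:
  "blinfun_apply (scale_blinfun scale c T) x = scale c (blinfun_apply T x)"
  unfolding scale_blinfun_def
  by (subst bounded_linear_Blinfun_apply)
     (auto intro!: bounded_linear_compose[OF bounded_bilinear.bounded_linear_right
         [OF bounded_bilinear_scale]] blinfun.bounded_linear_right)

lemma scale_bcontfun_apply:
  "apply_bcontfun (scale_bcontfun scale c f) w = scale c (apply_bcontfun f w)"
proof -
  interpret s: bounded_linear "scale c"
    by (rule bounded_bilinear.bounded_linear_right[OF bounded_bilinear_scale])
  have "bounded (range (\<lambda>w. scale c (apply_bcontfun f w)))"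
    using bounded_linear_image[OF bounded_apply_bcontfun s.bounded_linear_axioms, of f]
    by (simp add: image_image)
  then have "(\<lambda>w. scale c (apply_bcontfun f w)) \<in> bcontfun"
    by (auto simp: bcontfun_def intro!: s.continuous_on)
  then show ?thesis by (simp add: scale_bcontfun_def Bcontfun_inverse)
qed

lemma elem_fun_apply:
  "apply_bcontfun (elem_fun scale \<phi> x) w = scale (apply_bcontfun \<phi> w) x"
proof -
  interpret s: bounded_linear "\<lambda>c. scale c x"
    by (rule bounded_bilinear.bounded_linear_left[OF bounded_bilinear_scale])
  have "bounded (range (\<lambda>w. scale (apply_bcontfun \<phi> w) x))"
    using bounded_linear_image[OF bounded_apply_bcontfun s.bounded_linear_axioms, of \<phi>]
    by (simp add: image_image)
  then have "(\<lambda>w. scale (apply_bcontfun \<phi> w) x) \<in> bcontfun"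
    by (auto simp: bcontfun_def intro!: s.continuous_on)
  then show ?thesis by (simp add: elem_fun_def Bcontfun_inverse)
qed

lemma normed_space_over_scale_blinfun:
  "normed_space_over (scale_blinfun scale :: 'k \<Rightarrow> ('c::real_normed_vector \<Rightarrow>\<^sub>L 'a) \<Rightarrow> _)"
proof
  fix c and T :: "'c \<Rightarrow>\<^sub>L 'a"
  have le: "norm (scale_blinfun scale c T) \<le> norm c * norm T" for c and T :: "'c \<Rightarrow>\<^sub>L 'a"
    by (rule norm_blinfun_bound)
       (auto simp: scale_blinfun_apply norm_scale mult.assoc intro!: mult_left_mono norm_blinfun)
  show "norm (scale_blinfun scale c T) = norm c * norm T"
  proof (cases "c = 0")
    case True
    then show ?thesis using le[of c T] by simp
  next
    case False
    have "scale_blinfun scale (inverse c) (scale_blinfun scale c T) = T"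
      by (rule blinfun_eqI) (simp add: scale_blinfun_apply False)
    then have "norm T \<le> inverse (norm c) * norm (scale_blinfun scale c T)"
      using le[of "inverse c" "scale_blinfun scale c T"] by (simp add: norm_inverse)
    then show ?thesis using le[of c T] False by (simp add: field_simps)
  qed
qed (auto intro!: blinfun_eqI simp: scale_blinfun_apply blinfun.bilinear_simps
      scale_left_distrib scale_right_distrib scale_of_real)

lemma normed_space_over_scale_bcontfun:
  "normed_space_over (scale_bcontfun scale :: 'k \<Rightarrow> ('w::topological_space \<Rightarrow>\<^sub>C 'a) \<Rightarrow> _)"
proof
  fix c and f :: "'w \<Rightarrow>\<^sub>C 'a"
  have le: "norm (scale_bcontfun scale c f) \<le> norm c * norm f" for c and f :: "'w \<Rightarrow>\<^sub>C 'a"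
    by (rule norm_bound)
       (auto simp: scale_bcontfun_apply norm_scale intro!: mult_left_mono norm_bounded)
  show "norm (scale_bcontfun scale c f) = norm c * norm f"
  proof (cases "c = 0")
    case True
    then show ?thesis using le[of c f] by simp
  next
    case False
    have "scale_bcontfun scale (inverse c) (scale_bcontfun scale c f) = f"
      by (rule bcontfun_eqI) (simp add: scale_bcontfun_apply False)
    then have "norm f \<le> inverse (norm c) * norm (scale_bcontfun scale c f)"
      using le[of "inverse c" "scale_bcontfun scale c f"] by (simp add: norm_inverse)
    then show ?thesis using le[of c f] False by (simp add: field_simps)
  qed
qed (auto intro!: bcontfun_eqI simp: scale_bcontfun_apply
      scale_left_distrib scale_right_distrib scale_of_real)

end

definition conj_index :: "ereal \<Rightarrow> ereal"
  where "conj_index r = (if r = 1 then \<infinity> else if r = \<infinity> then 1 else r / (r - 1))"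

lemma conj_index_eq:
  assumes "1 \<le> r"
  shows "1 / r + 1 / conj_index r = 1" and "1 \<le> conj_index r"
  using assms
  by (cases r; auto simp: conj_index_def one_ereal_def divide_simps)+

definition lp_space :: "ereal \<Rightarrow> (nat \<Rightarrow> 'a::real_normed_vector) set"
  where "lp_space r = (if r = \<infinity> then {x. bounded (range x)}
           else {x. summable (\<lambda>n. norm (x n) powr real_of_ereal r)})"

definition lp_norm :: "ereal \<Rightarrow> (nat \<Rightarrow> 'a::real_normed_vector) \<Rightarrow> real"
  where "lp_norm r x = (if r = \<infinity> then (SUP n. norm (x n))
           else (\<Sum>n. norm (x n) powr real_of_ereal r) powr (1 / real_of_ereal r))"

(* the set of all \<Sum>\<alpha>\<^sub>n x\<^sub>n with (\<alpha>\<^sub>n) in the closed unit ball of \<ell>\<^sub>p' *)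
definition p_hull ::
  "real \<Rightarrow> ('k::rc_field \<Rightarrow> 'a::real_normed_vector \<Rightarrow> 'a) \<Rightarrow> (nat \<Rightarrow> 'a) \<Rightarrow> 'a set"
  where "p_hull p sa x =
    {y. \<exists>\<alpha>\<in>lp_space (conj_index (ereal p)).
          lp_norm (conj_index (ereal p)) \<alpha> \<le> 1 \<and> (\<lambda>n. sa (\<alpha> n) (x n)) sums y}"

definition Cp_space ::
  "real \<Rightarrow> ('k::rc_field \<Rightarrow> 'a::real_normed_vector \<Rightarrow> 'a) \<Rightarrow> ('w::topological_space \<Rightarrow>\<^sub>C 'a) set"
  where "Cp_space p sa =
    {f. \<exists>x\<in>lp_space (ereal p). range (apply_bcontfun f) \<subseteq> p_hull p sa x}"

definition Cp_norm ::
  "real \<Rightarrow> ('k::rc_field \<Rightarrow> 'a::real_normed_vector \<Rightarrow> 'a) \<Rightarrow> ('w::topological_space \<Rightarrow>\<^sub>C 'a) \<Rightarrow> real"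
  where "Cp_norm p sa f =
    Inf {lp_norm (ereal p) x |x.
           x \<in> lp_space (ereal p) \<and> range (apply_bcontfun f) \<subseteq> p_hull p sa x}"

(* L(C_p(\<Omega>,X),Y).  Since C_p(\<Omega>,X) is a subset of C(\<Omega>,X) with a norm of its own, its operators
   are functions on C(\<Omega>,X) whose values outside C_p(\<Omega>,X) are irrelevant. *)
definition Cp_operators ::
  "real \<Rightarrow> ('k::rc_field \<Rightarrow> 'a::real_normed_vector \<Rightarrow> 'a) \<Rightarrow> ('k \<Rightarrow> 'b::real_normed_vector \<Rightarrow> 'b)
    \<Rightarrow> (('w::topological_space \<Rightarrow>\<^sub>C 'a) \<Rightarrow> 'b) set"
  where "Cp_operators p sa sb =
    {U. (\<forall>f\<in>Cp_space p sa. \<forall>g\<in>Cp_space p sa. U (f + g) = U f + U g) \<and>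
        (\<forall>c. \<forall>f\<in>Cp_space p sa. U (scale_bcontfun sa c f) = sb c (U f)) \<and>
        (\<exists>B. \<forall>f\<in>Cp_space p sa. norm (U f) \<le> B * Cp_norm p sa f)}"

definition assoc_op ::
  "('k::rc_field \<Rightarrow> 'a::real_normed_vector \<Rightarrow> 'a) \<Rightarrow> (('w::topological_space \<Rightarrow>\<^sub>C 'a) \<Rightarrow> 'b)
    \<Rightarrow> ('w \<Rightarrow>\<^sub>C 'k) \<Rightarrow> 'a \<Rightarrow> 'b"
  where "assoc_op sa U \<phi> x = U (elem_fun sa \<phi> x)"

(* Rademacher cotype q of a linear subspace V, with the quadratic Rademacher mean; the mean over
   all choices of n signs is the integral over [0,1] with the first n Rademacher functions. *)
definition has_cotype :: "'a::real_normed_vector set \<Rightarrow> real \<Rightarrow> bool"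
  where "has_cotype V q \<longleftrightarrow>
    (\<exists>C. \<forall>n. \<forall>v \<in> {..<n} \<rightarrow> V.
       (\<Sum>i<n. norm (v i) powr q) powr (1 / q)
         \<le> C * sqrt ((\<Sum>e\<in>{..<n} \<rightarrow>\<^sub>E {-1, 1}. (norm (\<Sum>i<n. e i *\<^sub>R v i))\<^sup>2) / 2 ^ n))"

end

theory Submission
  imports Defs "HOL-Complex_Analysis.Great_Picard"
begin

(* U f is the limit of the Riemann sums \<Sum>S(h_a)(f a) over partitions of unity (h_a) that become
   fine with respect to f.  If f takes values in the p-hull of x, such a sum is a series
   \<Sum>S(\<phi>_n) x_n with \<Sum>|\<phi>_n|^{p'} \<le> 1.  Testing it against a functional on Y and applying
   Hoelder's inequality, it is bounded by a multiple of the l_p-norm of x as soon as every operator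
   from C(\<Omega>) to X^* is p'-summing.  Cotype q makes such operators (q,1)-summing, and an operator on
   C(\<Omega>) that is (q,1)-summing is r-summing for all r > q (Maurey, Pisier).  The Riemann sums converge
   because two fine partitions differ by a sum whose values lie in a p-hull of small norm: by
   compactness, small differences within the p-hull of x lie in the p-hull of a small sequence. *)

section \<open>Summing seminorms on spaces of continuous functions\<close>

text \<open>The summing step can be read through Pisier's domination theorem: an operator on
  C(Omega) is (q,1)-summing exactly if, on the unit ball, the q-th power of its norm is bounded by
  the integral of |f| against a fixed positive measure. \<open>weighted_summing\<close> is a finite,
  measure-free form of that domination, and cutting functions at dyadic levels turns it into
  r-summability. The constant of the cut degenerates as r approaches q; with r = p' this is where p
  < q' enters as a strict inequality. Cotype is assumed for X^* and not for L(X,Y), so operators are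
  composed with functionals on Y, and all bounds have to be uniform over these functionals. The
  operator U is controlled only by the norm of C_p, so uniform closeness of a sum of elementary
  tensors to f does not suffice for convergence. It has to be upgraded to smallness in the norm of
  C_p, and this is what compactness of the p-hull provides.\<close>

lemma powr_le_one_imp_le_one:
  fixes x s :: real
  assumes "x powr s \<le> 1" "0 < s" "0 \<le> x" shows "x \<le> 1"
proof (rule ccontr)
  assume "\<not> x \<le> 1"
  then have "1 powr s < x powr s" using assms(2) by (intro powr_less_mono2) auto
  then show False using assms(1) by simp
qed

lemma powr_convex_combination:
  fixes a b t q :: real
  assumes "1 \<le> q" "0 \<le> a" "0 \<le> b" "0 \<le> t" "t \<le> 1"
  shows "((1 - t) * a + t * b) powr q \<le> (1 - t) * a powr q + t * b powr q"
proof -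
  have le: "(c * x) powr q \<le> c * x powr q" if "0 \<le> c" "c \<le> 1" "0 \<le> x" for c x :: real
    using that assms(1) powr_mono'[of 1 q c] by (auto simp: powr_mult intro!: mult_right_mono)
  show ?thesis
  proof (cases "a = 0 \<or> b = 0")
    case True
    then show ?thesis using le[of "1 - t" a] le[of t b] assms by auto
  next
    case False
    then show ?thesis using convex_onD[OF powr_convex[OF assms(1)], of t a b] assms by simp
  qed
qed

text \<open>If the \<open>x i\<close> are probabilities of independent events, the sum is the
  probability that exactly one of them occurs. The induction closes only after the probability that
  none occurs has been added.\<close>

lemma sum_mult_prod_one_minus_le:
  fixes x :: "'i \<Rightarrow> real"
  assumes "finite I" "\<And>i. i \<in> I \<Longrightarrow> 0 \<le> x i \<and> x i \<le> 1"
  shows "(\<Sum>i\<in>I. x i * (\<Prod>j\<in>I - {i}. 1 - x j)) \<le> 1"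
proof -
  have "(\<Sum>i\<in>I. x i * (\<Prod>j\<in>I - {i}. 1 - x j)) + (\<Prod>j\<in>I. 1 - x j) \<le> 1"
    using assms
  proof (induction I rule: finite_induct)
    case (insert k I)
    let ?P = "\<Prod>j\<in>I. 1 - x j" and ?S = "\<Sum>i\<in>I. x i * (\<Prod>j\<in>I - {i}. 1 - x j)"
    have P: "0 \<le> ?P" "?P \<le> 1" using insert.prems by (auto intro!: prod_nonneg prod_le_1)
    have "(\<Sum>i\<in>I. x i * (\<Prod>j\<in>insert k I - {i}. 1 - x j)) = (1 - x k) * ?S"
    proof (subst sum_distrib_left, intro sum.cong refl)
      fix i assume "i \<in> I"
      then have "insert k I - {i} = insert k (I - {i})" using insert.hyps by auto
      then show "x i * (\<Prod>j\<in>insert k I - {i}. 1 - x j) = (1 - x k) * (x i * (\<Prod>j\<in>I - {i}. 1 - x j))"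
        using insert.hyps by simp
    qed
    moreover have "insert k I - {k} = I" using insert.hyps by auto
    ultimately have "(\<Sum>i\<in>insert k I. x i * (\<Prod>j\<in>insert k I - {i}. 1 - x j)) + (\<Prod>j\<in>insert k I. 1 - x j)
        = (1 - x k) * (?S + ?P) + x k * ?P"
      using insert.hyps by (simp add: algebra_simps)
    also have "\<dots> \<le> (1 - x k) * 1 + x k * 1"
      using insert P by (intro add_mono mult_left_mono) auto
    finally show ?case by simp
  qed simp
  moreover have "0 \<le> (\<Prod>j\<in>I. 1 - x j)" using assms by (auto intro!: prod_nonneg)
  ultimately show ?thesis by linarith
qed

text \<open>The constant of \<open>large_slice\<close>: the numerator comes from the shares allotted
  to the dyadic slices, with ratio 2 powr (1 - r/q), the denominator from the lowest level N f / (2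
  B). The condition \<open>q < r\<close> makes the ratio smaller than 1 and the constant
  positive.\<close>

definition slice_const :: "real \<Rightarrow> real \<Rightarrow> real \<Rightarrow> real"
  where "slice_const B q r = ((1 - 2 powr (1 - r/q)) * B) powr q / (2 * B) powr r"

lemma slice_const_pos:
  assumes "0 < B" "0 < q" "q < r" shows "0 < slice_const B q r"
proof -
  have "2 powr (1 - r/q) < (1::real)" using assms by (auto intro!: powr_less_one)
  then show ?thesis using assms by (simp add: slice_const_def)
qed

text \<open>In the application \<open>N f\<close> is the norm of \<open>y o\<^sub>L T f\<close> for
  a functional \<open>y\<close> on Y. Functions are plain maps with continuity as a hypothesis, so
  that truncations and products can be written pointwise. \<open>K\<close> bounds the sum of q-th
  powers itself, without a q-th root.\<close>

locale summing_seminorm =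
  fixes N :: "('w::topological_space \<Rightarrow> 'k::real_normed_vector) \<Rightarrow> real" and B K q :: real
  assumes triangle: "\<And>f g. continuous_on UNIV f \<Longrightarrow> continuous_on UNIV g \<Longrightarrow> N (\<lambda>w. f w + g w) \<le> N f + N g"
    and homogeneous: "\<And>f c. continuous_on UNIV f \<Longrightarrow> N (\<lambda>w. c *\<^sub>R f w) = \<bar>c\<bar> * N f"
    and bound: "\<And>f. continuous_on UNIV f \<Longrightarrow> (\<And>w. norm (f w) \<le> 1) \<Longrightarrow> N f \<le> B"
    and B_pos: "0 < B" and q_ge: "1 \<le> q" and K_nonneg: "0 \<le> K"
    and q1_summing: "\<And>n f. (\<And>i. i < n \<Longrightarrow> continuous_on UNIV (f i)) \<Longrightarrow>
        (\<And>w. (\<Sum>i<n. norm (f i w)) \<le> 1) \<Longrightarrow> (\<Sum>i<(n::nat). N (f i) powr q) \<le> K"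
begin

lemma N_zero: "N (\<lambda>w. 0) = 0"
  using homogeneous[of "\<lambda>w. 0" 0] by simp

lemma N_nonneg: "continuous_on UNIV f \<Longrightarrow> 0 \<le> N f"
  using triangle[of f "\<lambda>w. (-1) *\<^sub>R f w"] homogeneous[of f "-1"] N_zero
  by (simp add: continuous_intros)

lemma N_sum_le:
  assumes "\<And>j. j < n \<Longrightarrow> continuous_on UNIV (d j)"
  shows "N (\<lambda>w. \<Sum>j<(n::nat). d j w) \<le> (\<Sum>j<n. N (d j))"
  using assms
proof (induction n)
  case (Suc n)
  have "N (\<lambda>w. (\<Sum>j<n. d j w) + d n w) \<le> N (\<lambda>w. \<Sum>j<n. d j w) + N (d n)"
    using Suc.prems by (intro triangle continuous_on_sum) auto
  with Suc show ?case by fastforce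
qed (simp add: N_zero)

lemma N_le:
  assumes "continuous_on UNIV f" "\<And>w. norm (f w) \<le> c" "0 < c"
  shows "N f \<le> c * B"
proof -
  have "N (\<lambda>w. (1/c) *\<^sub>R f w) \<le> B"
    using assms by (intro bound continuous_intros) (auto simp: field_simps)
  then show ?thesis using homogeneous[OF assms(1), of "1/c"] assms(3) by (simp add: field_simps)
qed

lemma N_convex:
  assumes "continuous_on UNIV f" "continuous_on UNIV g" "0 \<le> t" "t \<le> 1"
  shows "N (\<lambda>w. (1 - t) *\<^sub>R f w + t *\<^sub>R g w) powr q \<le> (1 - t) * N f powr q + t * N g powr q"
proof -
  have "N (\<lambda>w. (1 - t) *\<^sub>R f w + t *\<^sub>R g w) \<le> (1 - t) * N f + t * N g"
    using triangle[of "\<lambda>w. (1 - t) *\<^sub>R f w" "\<lambda>w. t *\<^sub>R g w"] assms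
    by (simp add: continuous_intros homogeneous)
  then have "N (\<lambda>w. (1 - t) *\<^sub>R f w + t *\<^sub>R g w) powr q \<le> ((1 - t) * N f + t * N g) powr q"
    using assms q_ge by (intro powr_mono2 N_nonneg continuous_intros) auto
  also have "\<dots> \<le> (1 - t) * N f powr q + t * N g powr q"
    using assms q_ge by (intro powr_convex_combination N_nonneg) auto
  finally show ?thesis .
qed

(* The left-hand side is a convex function of each weight separately, so it is enough to bound
   it when all weights are 0 or 1, where the functions inside N are dominated by a
   sum of products of which the sum is at most 1. *)
lemma weighted_disjointification:
  assumes f: "\<And>i. i < n \<Longrightarrow> continuous_on UNIV (f i)"
    and \<psi>: "\<And>i. i < n \<Longrightarrow> continuous_on UNIV (\<psi> i)"
    and f_le: "\<And>i w. i < n \<Longrightarrow> norm (f i w) \<le> \<psi> i w" and \<psi>_le: "\<And>i w. i < n \<Longrightarrow> \<psi> i w \<le> 1"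
    and \<delta>: "\<And>i. i < (n::nat) \<Longrightarrow> 0 \<le> \<delta> i \<and> \<delta> i \<le> 1"
  shows "(\<Sum>i<n. \<delta> i * N (\<lambda>w. (\<Prod>j\<in>{..<n} - {i}. 1 - \<delta> j * \<psi> j w) *\<^sub>R f i w) powr q) \<le> K"
proof -
  define g where "g \<delta> i = (\<lambda>w. (\<Prod>j\<in>{..<n} - {i}. 1 - \<delta> j * \<psi> j w) *\<^sub>R f i w)" for \<delta> i
  define F where "F \<delta> = (\<Sum>i<n. \<delta> i * N (g \<delta> i) powr q)" for \<delta>
  have g_cont: "continuous_on UNIV (g \<delta> i)" if "i < n" for \<delta> i
    unfolding g_def using that f \<psi> by (auto intro!: continuous_intros)
  have \<psi>_nonneg: "0 \<le> \<psi> i w" if "i < n" for i w using f_le[OF that, of w] norm_ge_zero order_trans by blast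
  have vertex: "F \<delta> \<le> K" if "\<And>i. i < n \<Longrightarrow> \<delta> i = 0 \<or> \<delta> i = 1" for \<delta>
  proof -
    have "\<delta> i * N (g \<delta> i) powr q = N (\<lambda>w. \<delta> i *\<^sub>R g \<delta> i w) powr q" if "i < n" for i
      using \<open>\<And>i. i < n \<Longrightarrow> \<delta> i = 0 \<or> \<delta> i = 1\<close>[OF that] homogeneous[OF g_cont[OF that]] N_zero by auto
    then have "F \<delta> = (\<Sum>i<n. N (\<lambda>w. \<delta> i *\<^sub>R g \<delta> i w) powr q)" by (simp add: F_def)
    also have "\<dots> \<le> K"
    proof (rule q1_summing)
      fix w
      have x: "0 \<le> \<delta> i * \<psi> i w \<and> \<delta> i * \<psi> i w \<le> 1" if "i < n" for i
        using \<psi>_nonneg[OF that] \<psi>_le[OF that] \<open>\<And>i. i < n \<Longrightarrow> \<delta> i = 0 \<or> \<delta> i = 1\<close>[OF that] by auto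
      have "norm (\<delta> i *\<^sub>R g \<delta> i w) \<le> \<delta> i * \<psi> i w * (\<Prod>j\<in>{..<n} - {i}. 1 - \<delta> j * \<psi> j w)" if "i < n" for i
      proof -
        have "0 \<le> (\<Prod>j\<in>{..<n} - {i}. 1 - \<delta> j * \<psi> j w)" using x by (auto intro!: prod_nonneg)
        then show ?thesis using that f_le[OF that, of w] \<open>\<And>i. i < n \<Longrightarrow> \<delta> i = 0 \<or> \<delta> i = 1\<close>[OF that]
          by (auto simp: g_def mult.commute[of "norm _"] mult.commute[of "\<psi> i w"] intro!: mult_left_mono)
      qed
      then have "(\<Sum>i<n. norm (\<delta> i *\<^sub>R g \<delta> i w)) \<le> (\<Sum>i<n. \<delta> i * \<psi> i w * (\<Prod>j\<in>{..<n} - {i}. 1 - \<delta> j * \<psi> j w))"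
        by (intro sum_mono) auto
      also have "\<dots> \<le> 1" using x by (intro sum_mult_prod_one_minus_le) auto
      finally show "(\<Sum>i<n. norm (\<delta> i *\<^sub>R g \<delta> i w)) \<le> 1" .
    qed (auto intro!: continuous_intros g_cont)
    finally show ?thesis .
  qed
  \<comment> \<open>Only the factor \<open>j = m\<close> of a product depends on
    \<open>\<delta> m\<close>, and it does so affinely, so \<open>N_convex\<close> applies. The term
    \<open>i = m\<close> omits this factor and carries \<open>\<delta> m\<close> linearly.\<close>
  have split: "F \<delta> \<le> (1 - \<delta> m) * F (\<delta>(m := 0)) + \<delta> m * F (\<delta>(m := 1))"
    if m: "m < n" and \<delta>: "\<And>i. i < n \<Longrightarrow> 0 \<le> \<delta> i \<and> \<delta> i \<le> 1" for m \<delta>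
  proof -
    have "\<delta> i * N (g \<delta> i) powr q \<le>
       (1 - \<delta> m) * ((\<delta>(m := 0)) i * N (g (\<delta>(m := 0)) i) powr q) +
       \<delta> m * ((\<delta>(m := 1)) i * N (g (\<delta>(m := 1)) i) powr q)" if i: "i < n" for i
    proof (cases "i = m")
      case True
      have "g (\<delta>(m := 1)) m = g \<delta> m" by (auto simp: g_def intro!: ext prod.cong)
      then show ?thesis using True by simp
    next
      case False
      have eq: "{..<n} - {i} = insert m ({..<n} - {i} - {m})" using False m by auto
      have "g \<delta> i w = (1 - \<delta> m) *\<^sub>R g (\<delta>(m := 0)) i w + \<delta> m *\<^sub>R g (\<delta>(m := 1)) i w" for w
      proof -
        let ?P = "\<Prod>j\<in>{..<n} - {i} - {m}. 1 - \<delta> j * \<psi> j w"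
        have *: "(\<Prod>j\<in>{..<n} - {i} - {m}. 1 - (\<delta>(m := c)) j * \<psi> j w) = ?P" for c
          by (intro prod.cong) auto
        have "(\<Prod>j\<in>{..<n} - {i}. 1 - (\<delta>(m := c)) j * \<psi> j w) = (1 - c * \<psi> m w) * ?P" for c
          by (subst eq, subst prod.insert) (auto simp: *[simplified])
        then have g_eq: "g (\<delta>(m := c)) i w = ((1 - c * \<psi> m w) * ?P) *\<^sub>R f i w" for c
          unfolding g_def by simp
        from g_eq[of "\<delta> m"] have "g \<delta> i w = ((1 - \<delta> m * \<psi> m w) * ?P) *\<^sub>R f i w" by simp
        then show ?thesis
          unfolding g_eq by (simp add: algebra_simps)
      qed
      then have "g \<delta> i = (\<lambda>w. (1 - \<delta> m) *\<^sub>R g (\<delta>(m := 0)) i w + \<delta> m *\<^sub>R g (\<delta>(m := 1)) i w)" by blast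
      then have "N (g \<delta> i) powr q \<le> (1 - \<delta> m) * N (g (\<delta>(m := 0)) i) powr q + \<delta> m * N (g (\<delta>(m := 1)) i) powr q"
        using N_convex[OF g_cont[OF i] g_cont[OF i], of "\<delta> m" "\<delta>(m := 0)" "\<delta>(m := 1)"] \<delta>[OF m] by simp
      from mult_left_mono[OF this, of "\<delta> i"] show ?thesis using \<delta>[OF i] False by (simp add: algebra_simps)
    qed
    then show ?thesis unfolding F_def sum_distrib_left sum.distrib[symmetric] by (intro sum_mono) auto
  qed
  \<comment> \<open>The first \<open>m\<close> weights may be fractional; the induction step moves
    the last of these to 0 and to 1.\<close>
  have "F \<delta> \<le> K" if "m \<le> n" "\<And>i. i < n \<Longrightarrow> 0 \<le> \<delta> i \<and> \<delta> i \<le> 1"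
    "\<And>i. m \<le> i \<Longrightarrow> i < n \<Longrightarrow> \<delta> i = 0 \<or> \<delta> i = 1" for m \<delta>
    using that
  proof (induction m arbitrary: \<delta>)
    case 0
    then show ?case using vertex by simp
  next
    case (Suc m)
    have IH: "F (\<delta>(m := c)) \<le> K" if "c = 0 \<or> c = 1" for c
      using that Suc.prems by (intro Suc.IH) (auto simp: Suc_le_eq)
    have d: "0 \<le> \<delta> m" "\<delta> m \<le> 1" using Suc.prems by auto
    have "F \<delta> \<le> (1 - \<delta> m) * F (\<delta>(m := 0)) + \<delta> m * F (\<delta>(m := 1))"
      using Suc.prems by (intro split) auto
    also have "\<dots> \<le> (1 - \<delta> m) * K + \<delta> m * K"
      using d IH by (intro add_mono mult_left_mono) auto
    finally show ?case by (simp add: algebra_simps)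
  qed
  from this[of n \<delta>] \<delta> show ?thesis unfolding F_def g_def by auto
qed

text \<open>This is Pisier's domination with the measure eliminated. By the Weierstrass product
  inequality the products in \<open>weighted_disjointification\<close> are at least 1 - 1/2, so the
  functions can be divided by them in advance.\<close>

lemma weighted_summing:
  assumes f: "\<And>i. i < n \<Longrightarrow> continuous_on UNIV (f i)"
    and f_le: "\<And>i w. i < n \<Longrightarrow> norm (f i w) \<le> 1"
    and \<delta>: "\<And>i. i < (n::nat) \<Longrightarrow> 0 \<le> \<delta> i \<and> \<delta> i \<le> 1"
    and sum_le: "\<And>w. (\<Sum>i<n. \<delta> i * norm (f i w)) \<le> 1/2"
  shows "(\<Sum>i<n. \<delta> i * N (f i) powr q) \<le> 2 powr q * K"
proof -
  define g where "g i w = (\<Prod>j\<in>{..<n} - {i}. 1 - \<delta> j * norm (f j w))" for i w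
  have g_ge: "1/2 \<le> g i w" if "i < n" for i w
  proof -
    have le1: "\<delta> j * norm (f j w) \<le> 1" if "j < n" for j
      using \<delta>[OF that] f_le[OF that, of w] mult_mono[of "\<delta> j" 1 "norm (f j w)" 1] by simp
    have "1 - (\<Sum>j\<in>{..<n} - {i}. \<delta> j * norm (f j w)) \<le> g i w"
      unfolding g_def using \<delta> le1
      by (intro Weierstrass_prod_ineq) auto
    moreover have "(\<Sum>j\<in>{..<n} - {i}. \<delta> j * norm (f j w)) \<le> (\<Sum>j<n. \<delta> j * norm (f j w))"
      using \<delta> by (intro sum_mono2) auto
    ultimately show ?thesis using sum_le[of w] by linarith
  qed
  have g_cont: "continuous_on UNIV (g i)" for i
    unfolding g_def using f by (auto intro!: continuous_intros)
  \<comment> \<open>The factor \<open>1 / (2 * g i w)\<close> is at most 1, which keeps the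
    domination by \<open>norm (f i w)\<close>, and it turns the argument of \<open>N\<close> into
    half of \<open>f i\<close>. This half is the origin of \<open>2 powr q\<close>.\<close>
  have "(\<Sum>i<n. \<delta> i * N (\<lambda>w. g i w *\<^sub>R ((1 / (2 * g i w)) *\<^sub>R f i w)) powr q) \<le> K"
    unfolding g_def
  proof (rule weighted_disjointification[where \<psi> = "\<lambda>i w. norm (f i w)"], goal_cases)
    case (1 i)
    show ?case unfolding g_def[symmetric]
      using g_ge[OF 1] by (intro continuous_intros g_cont f[OF 1]) (metis mult_eq_0_iff not_one_le_zero
          le_divide_eq_1 zero_neq_numeral divide_le_0_1_iff not_numeral_le_zero)
  next
    case (3 i w)
    show ?case unfolding g_def[symmetric]
      using g_ge[OF 3, of w] mult_left_mono[of 1 "2 * g i w" "norm (f i w)"]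
      by (auto simp: divide_simps)
  qed (use f f_le \<delta> in \<open>auto intro!: continuous_intros\<close>)
  also have "(\<Sum>i<n. \<delta> i * N (\<lambda>w. g i w *\<^sub>R ((1 / (2 * g i w)) *\<^sub>R f i w)) powr q) =
      (\<Sum>i<n. \<delta> i * ((1/2) powr q * N (f i) powr q))"
  proof (intro sum.cong refl)
    fix i assume "i \<in> {..<n}"
    then have i: "i < n" by simp
    have "g i w *\<^sub>R ((1 / (2 * g i w)) *\<^sub>R f i w) = (1/2) *\<^sub>R f i w" for w
      using g_ge[OF i, of w] by simp
    then have "N (\<lambda>w. g i w *\<^sub>R ((1 / (2 * g i w)) *\<^sub>R f i w)) = N (\<lambda>w. (1/2) *\<^sub>R f i w)"
      by presburger
    also have "\<dots> = 1/2 * N (f i)"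
      using homogeneous[OF f[OF i], of "1/2"] by simp
    finally have "N (\<lambda>w. g i w *\<^sub>R ((1 / (2 * g i w)) *\<^sub>R f i w)) = 1/2 * N (f i)" .
    with N_nonneg[OF f[OF i]] show "\<delta> i * N (\<lambda>w. g i w *\<^sub>R ((1 / (2 * g i w)) *\<^sub>R f i w)) powr q = \<delta> i * ((1/2) powr q * N (f i) powr q)"
      by (simp only: powr_mult)
  qed
  also have "\<dots> = (\<Sum>i<n. \<delta> i * N (f i) powr q) / 2 powr q"
    by (simp add: powr_divide sum_divide_distrib)
  finally show ?thesis by (simp add: field_simps)
qed

(* Cut f at the levels t, 2t, 4t, ... with t = N f / (2 B).  The part below t accounts for at most
   half of N f, so some dyadic slice accounts for a share that decreases geometrically in the level. *)
lemma large_slice: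
  assumes "q < r" "continuous_on UNIV f" "bounded (range f)" "0 < N f"
  shows "\<exists>s u. 0 < s \<and> continuous_on UNIV u \<and> (\<forall>w. norm (u w) \<le> 1) \<and>
    (\<forall>w. norm (f w) \<le> s \<longrightarrow> u w = 0) \<and> slice_const B q r * N f powr r \<le> s powr r * N u powr q"
proof (rule ccontr)
  note f = assms(2) and bdd = assms(3) and pos = assms(4)
  \<comment> \<open>With this ratio (\<rho> / 2)^j equals 2 powr (- j r / q), so the threshold for
    slice j below matches the power \<open>s powr r\<close> exactly, while the shares (1 - \<rho>)
    \<rho>^j add up to at most 1.\<close>
  define \<rho> where "\<rho> = 2 powr (1 - r/q)"
  have q: "0 < q" using q_ge by simp
  have \<rho>: "0 < \<rho>" "\<rho> < 1" using assms q unfolding \<rho>_def by (auto intro!: powr_less_one)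
  have \<kappa>_def: "slice_const B q r = ((1 - \<rho>) * B) powr q / (2 * B) powr r"
    by (simp add: slice_const_def \<rho>_def)
  assume contra: "\<not> ?thesis"
  define t where "t = N f / (2 * B)"
  have t: "0 < t" using pos B_pos by (simp add: t_def)
  \<comment> \<open>Radial truncation: the direction of \<open>f w\<close> is kept and its norm
    becomes the minimum of \<open>s\<close> and \<open>norm (f w)\<close>.\<close>
  define clip where "clip s w = (s / max s (norm (f w))) *\<^sub>R f w" for s w
  have clip_cont: "continuous_on UNIV (clip s)" if "0 < s" for s
    unfolding clip_def using that by (intro continuous_intros f) auto
  have clip_id: "clip s w = f w" if "0 < s" "norm (f w) \<le> s" for s w
    using that by (simp add: clip_def max_def)
  define d where "d j w = clip (2 ^ Suc j * t) w - clip (2 ^ j * t) w" for j w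
  have d_cont: "continuous_on UNIV (d j)" for j
    unfolding d_def using t by (intro continuous_intros clip_cont) auto
  have d_le: "norm (d j w) \<le> 2 ^ j * t" for j w
  proof -
    let ?x = "norm (f w)" and ?s = "2 ^ j * t"
    have s: "0 < ?s" using t by simp
    have e: "2 ^ Suc j * t = 2 * ?s" by simp
    have "norm (d j w) = \<bar>2 * ?s / max (2 * ?s) ?x - ?s / max ?s ?x\<bar> * ?x"
      unfolding d_def clip_def e by (simp flip: scaleR_left_diff_distrib)
    also have "\<dots> \<le> ?s"
    proof -
      consider "?x \<le> ?s" | "?s < ?x" "?x \<le> 2 * ?s" | "2 * ?s < ?x" by linarith
      then show ?thesis using s
        by cases (auto simp: max_def abs_if field_simps)
    qed
    finally show ?thesis .
  qed
  \<comment> \<open>A slice violating this bound, divided by s = 2^j t, would be the function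
    \<open>u\<close> that \<open>contra\<close> excludes.\<close>
  have d_small: "N (d j) < (1 - \<rho>) * B * t * \<rho> ^ j" for j
  proof (rule ccontr)
    assume "\<not> ?thesis"
    then have ge: "(1 - \<rho>) * B * t * \<rho> ^ j \<le> N (d j)" by simp
    define s where "s = 2 ^ j * t"
    have s: "0 < s" using t by (simp add: s_def)
    define u where "u = (\<lambda>w. (1/s) *\<^sub>R d j w)"
    have Nu: "N u = N (d j) / s" unfolding u_def using homogeneous[OF d_cont, of "1/s" j] s by simp
    have "slice_const B q r * N f powr r = ((1 - \<rho>) * B) powr q * t powr r"
      using pos B_pos by (simp add: \<kappa>_def t_def powr_divide)
    also have "t powr r = s powr r * (\<rho> ^ j / 2 ^ j) powr q"
    proof -
      have "\<rho> ^ j / 2 ^ j = (2 ^ j) powr (- r/q)"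
      proof -
        have "\<rho> ^ j = (2 powr real j) powr (1 - r/q)"
          unfolding \<rho>_def powr_powr by (simp add: powr_realpow[symmetric] powr_powr mult.commute)
        then show ?thesis by (simp add: powr_realpow[symmetric] powr_diff[symmetric] powr_powr field_simps)
      qed
      then have "(\<rho> ^ j / 2 ^ j) powr q = (2 ^ j) powr (- r)"
        using q by (simp add: powr_powr)
      then show ?thesis using t by (simp add: s_def powr_mult powr_minus)
    qed
    also have "((1 - \<rho>) * B) powr q * (s powr r * (\<rho> ^ j / 2 ^ j) powr q) =
        s powr r * ((1 - \<rho>) * B * t * \<rho> ^ j / s) powr q"
      using t \<rho> B_pos by (simp add: s_def powr_mult powr_divide)
    also have "\<dots> \<le> s powr r * N u powr q"
      using ge s \<rho> B_pos t q unfolding Nu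
      by (intro mult_left_mono powr_mono2 divide_right_mono) auto
    finally have "slice_const B q r * N f powr r \<le> s powr r * N u powr q" .
    moreover have "continuous_on UNIV u" unfolding u_def by (intro continuous_intros d_cont)
    moreover have "norm (u w) \<le> 1" for w
      using d_le[of j w] s by (simp add: u_def s_def field_simps)
    moreover have "u w = 0" if "norm (f w) \<le> s" for w
    proof -
      have "clip (2 ^ Suc j * t) w = f w" "clip (2 ^ j * t) w = f w"
        using that s t by (auto intro!: clip_id order_trans[OF that] simp: s_def)
      then show ?thesis by (simp add: u_def d_def)
    qed
    ultimately show False using contra s by blast
  qed
  obtain M where M: "\<And>w. norm (f w) \<le> M" using bdd by (auto simp: bounded_iff)
  obtain J where J: "M / t < 2 ^ J" using real_arch_pow[of 2 "M / t"] by auto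
  have tele: "f w = clip t w + (\<Sum>j<J. d j w)" for w
  proof -
    have "(\<Sum>j<J. d j w) = clip (2 ^ J * t) w - clip (2 ^ 0 * t) w"
      unfolding d_def by (rule sum_lessThan_telescope)
    moreover have "clip (2 ^ J * t) w = f w"
      using J M[of w] t by (intro clip_id) (auto simp: field_simps intro: order_trans)
    ultimately show ?thesis by simp
  qed
  \<comment> \<open>The part below level t contributes at most t B and the finitely many slices
    together strictly less than t B, whereas t was chosen with 2 t B = N f.\<close>
  have "N f = N (\<lambda>w. clip t w + (\<Sum>j<J. d j w))" by (simp flip: tele)
  also have "\<dots> \<le> N (clip t) + (\<Sum>j<J. N (d j))"
    using triangle[OF clip_cont[OF t], of "\<lambda>w. \<Sum>j<J. d j w"] N_sum_le[of J d] d_cont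
    by (force intro!: continuous_intros)
  also have "N (clip t) \<le> t * B"
    using t by (intro N_le clip_cont) (auto simp: clip_def max_def field_simps)
  also have "(\<Sum>j<J. N (d j)) < t * B"
  proof -
    have "(\<Sum>j<J. N (d j)) \<le> (\<Sum>j<J. (1 - \<rho>) * B * t * \<rho> ^ j)"
      using d_small by (intro sum_mono less_imp_le)
    also have "\<dots> = B * t * (1 - \<rho> ^ J)"
      using \<rho> by (simp add: sum_distrib_left[symmetric] sum_gp_strict)
    also have "\<dots> < B * t * 1" using B_pos t \<rho> by (intro mult_strict_left_mono) auto
    finally show ?thesis by (simp add: mult.commute)
  qed
  finally show False using B_pos by (simp add: t_def)
qed

text \<open>Each \<open>f i\<close> is replaced by its large slice \<open>u i\<close>. As
  \<open>u i\<close> vanishes where \<open>norm (f i w) \<le> s i\<close> and has norm at most 1,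
  \<open>s i powr r * norm (u i w)\<close> stays below \<open>norm (f i w) powr r\<close>. The
  condition on r-th powers thus becomes a linear one with weights, as
  \<open>weighted_summing\<close> requires.\<close>

lemma r_summing:
  assumes "q < r" and f: "\<And>i. i < n \<Longrightarrow> continuous_on UNIV (f i)"
    and sum_le: "\<And>w. (\<Sum>i<n. norm (f i w) powr r) \<le> 1"
  shows "(\<Sum>i<(n::nat). N (f i) powr r) \<le> 2 * 2 powr q * K / slice_const B q r"
proof -
  have r: "0 < r" using assms(1) q_ge by simp
  define \<kappa> where "\<kappa> = slice_const B q r"
  have \<kappa>: "0 < \<kappa>" unfolding \<kappa>_def using assms(1) q_ge B_pos by (intro slice_const_pos) auto
  have f_le: "norm (f i w) \<le> 1" if "i < n" for i w
  proof -
    have "norm (f i w) powr r \<le> (\<Sum>i<n. norm (f i w) powr r)" using that by (intro member_le_sum) auto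
    then have "norm (f i w) powr r \<le> 1 powr r" using sum_le[of w] by simp
    then show ?thesis using r powr_le_one_imp_le_one[of "norm (f i w)" r] by simp
  qed
  have ex: "\<exists>s u. 0 \<le> s \<and> s \<le> 1 \<and> continuous_on UNIV u \<and> (\<forall>w. norm (u w) \<le> 1) \<and>
      (\<forall>w. s powr r * norm (u w) \<le> norm (f i w) powr r) \<and> \<kappa> * N (f i) powr r \<le> s powr r * N u powr q"
    if i: "i < n" for i
  proof (cases "0 < N (f i)")
    case True
    have "bounded (range (f i))" using f_le[OF i] by (auto simp: bounded_iff)
    from large_slice[OF assms(1) f[OF i] this True, folded \<kappa>_def] obtain s u where su: "0 < s" "continuous_on UNIV u" "\<And>w. norm (u w) \<le> 1"
      "\<And>w. norm (f i w) \<le> s \<Longrightarrow> u w = 0" "\<kappa> * N (f i) powr r \<le> s powr r * N u powr q" by blast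
    have "s powr r * norm (u w) \<le> norm (f i w) powr r" for w
    proof (cases "norm (f i w) \<le> s")
      case False
      then have "s powr r * norm (u w) \<le> s powr r * 1" by (intro mult_left_mono su) auto
      also have "\<dots> \<le> norm (f i w) powr r" using False su(1) r by (simp add: powr_mono2)
      finally show ?thesis .
    qed (simp add: su(4))
    \<comment> \<open>The weights of \<open>weighted_summing\<close> must lie in the unit interval.
      A level above 1 would make the slice vanish identically, because
      \<open>norm (f i w) \<le> 1\<close>.\<close>
    moreover have "s \<le> 1"
    proof (rule ccontr)
      assume "\<not> s \<le> 1"
      then have "u = (\<lambda>w. 0)" using su(4) f_le[OF i] by (fastforce intro: order_trans)
      then have "\<kappa> * N (f i) powr r \<le> 0" using su(5) N_zero by simp
      then show False using \<kappa> True by (simp add: mult_le_0_iff)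
    qed
    ultimately show ?thesis using su by (intro exI[of _ s] exI[of _ u]) auto
  next
    case False
    then have "N (f i) = 0" using N_nonneg[OF f[OF i]] by simp
    then show ?thesis by (intro exI[of _ 0] exI[of _ "\<lambda>w. 0"]) auto
  qed
  define Q where "Q i s u \<longleftrightarrow> 0 \<le> s \<and> s \<le> 1 \<and> continuous_on UNIV u \<and> (\<forall>w. norm (u w) \<le> 1) \<and>
      (\<forall>w. s powr r * norm (u w) \<le> norm (f i w) powr r) \<and> \<kappa> * N (f i) powr r \<le> s powr r * N u powr q"
    for i and s :: real and u :: "'w \<Rightarrow> 'k"
  have "\<forall>i\<in>{..<n}. \<exists>x. Q i (fst x) (snd x)" using ex by (simp add: Q_def)
  then obtain x where x: "\<forall>i\<in>{..<n}. Q i (fst (x i)) (snd (x i))" by (rule bchoice[THEN exE])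
  define s u where "s i = fst (x i)" and "u i = snd (x i)" for i
  have su: "0 \<le> s i" "s i \<le> 1" "continuous_on UNIV (u i)" "norm (u i w) \<le> 1"
      "s i powr r * norm (u i w) \<le> norm (f i w) powr r"
      "\<kappa> * N (f i) powr r \<le> s i powr r * N (u i) powr q" if "i < n" for i w
    using x that by (auto simp: Q_def s_def u_def)
  \<comment> \<open>Halving the weights meets the bound 1/2 of \<open>weighted_summing\<close> and
    produces the leading factor 2 of the constant.\<close>
  have "(\<Sum>i<n. (s i powr r / 2) * N (u i) powr q) \<le> 2 powr q * K"
  proof (rule weighted_summing)
    show "0 \<le> s i powr r / 2 \<and> s i powr r / 2 \<le> 1" if "i < n" for i
      using su(1,2)[OF that] r powr_mono2[of r "s i" 1] by simp
    fix w
    have "(\<Sum>i<n. s i powr r / 2 * norm (u i w)) \<le> (\<Sum>i<n. norm (f i w) powr r / 2)"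
      using su(5) by (intro sum_mono) auto
    also have "\<dots> \<le> 1/2" using sum_le[of w] by (simp flip: sum_divide_distrib)
    finally show "(\<Sum>i<n. s i powr r / 2 * norm (u i w)) \<le> 1/2" .
  qed (use su in auto)
  moreover have "(\<Sum>i<n. \<kappa> * N (f i) powr r) \<le> (\<Sum>i<n. s i powr r * N (u i) powr q)"
    using su(6) by (intro sum_mono) auto
  ultimately have "\<kappa> * (\<Sum>i<n. N (f i) powr r) \<le> 2 * 2 powr q * K"
    by (simp add: sum_distrib_left sum_divide_distrib[symmetric])
  then show ?thesis using \<kappa> by (simp add: field_simps flip: \<kappa>_def)
qed

end

section \<open>Norming functionals\<close>

definition sublinear :: "('a::real_vector \<Rightarrow> real) \<Rightarrow> bool"
  where "sublinear q \<longleftrightarrow> (\<forall>x y. q (x + y) \<le> q x + q y) \<and> (\<forall>c\<ge>0. \<forall>x. q (c *\<^sub>R x) = c * q x)"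

lemma sublinearI:
  assumes "\<And>x y. q (x + y) \<le> q x + q y" "\<And>c x. 0 < c \<Longrightarrow> q (c *\<^sub>R x) \<le> c * q x" "q 0 = 0"
  shows "sublinear q"
  unfolding sublinear_def
proof (intro conjI allI impI assms(1))
  fix c :: real and x assume "0 \<le> c"
  show "q (c *\<^sub>R x) = c * q x"
  proof (cases "c = 0")
    case False
    then have "0 < c" using \<open>0 \<le> c\<close> by simp
    from assms(2)[of c x] assms(2)[of "1/c" "c *\<^sub>R x"] this show ?thesis
      by (simp add: field_simps)
  qed (simp add: assms(3))
qed

lemma sublinear_zero: "sublinear q \<Longrightarrow> q 0 = 0"
  unfolding sublinear_def by (metis mult_zero_left order_refl scaleR_zero_left)

lemma sublinear_minus: "sublinear q \<Longrightarrow> - q (- x) \<le> q x"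
  using sublinear_zero[of q] unfolding sublinear_def by (metis add.right_inverse minus_le_iff neg_0_le_iff_le
      add_le_cancel_left le_add_same_cancel1 add.commute minus_add_cancel)

(* The largest sublinear functional below q whose value at -y is at most -q(y). *)
definition shift :: "('a::real_vector \<Rightarrow> real) \<Rightarrow> 'a \<Rightarrow> 'a \<Rightarrow> real"
  where "shift q y x = (INF t\<in>{0..}. q (x + t *\<^sub>R y) - t * q y)"

lemma shift_bdd_below:
  assumes "sublinear q"
  shows "bdd_below ((\<lambda>t. q (x + t *\<^sub>R y) - t * q y) ` {0..})"
proof (rule bdd_belowI2[of _ "- q (- x)"])
  fix t :: real assume "t \<in> {0..}"
  then have "t * q y = q (t *\<^sub>R y)" using assms by (simp add: sublinear_def)
  also have "\<dots> \<le> q (x + t *\<^sub>R y) + q (- x)"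
    using assms unfolding sublinear_def by (metis add_minus_cancel add.commute)
  finally show "- q (- x) \<le> q (x + t *\<^sub>R y) - t * q y" by simp
qed

lemma shift_le: "sublinear q \<Longrightarrow> 0 \<le> t \<Longrightarrow> shift q y x \<le> q (x + t *\<^sub>R y) - t * q y"
  unfolding shift_def by (rule cINF_lower[OF shift_bdd_below]) auto

lemma le_shift:
  assumes "\<And>t. 0 \<le> t \<Longrightarrow> c \<le> q (x + t *\<^sub>R y) - t * q y"
  shows "c \<le> shift q y x"
  unfolding shift_def using assms by (intro cINF_greatest) auto

lemma sublinear_shift:
  assumes q: "sublinear q"
  shows "sublinear (shift q y)"
proof (rule sublinearI)
  fix x z
  have "shift q y (x + z) - (q (x + s *\<^sub>R y) - s * q y) \<le> q (z + t *\<^sub>R y) - t * q y"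
    if "0 \<le> s" "0 \<le> t" for s t
  proof -
    have "shift q y (x + z) \<le> q ((x + s *\<^sub>R y) + (z + t *\<^sub>R y)) - (s + t) * q y"
      using shift_le[OF q, of "s + t" y "x + z"] that by (simp add: algebra_simps)
    also have "\<dots> \<le> q (x + s *\<^sub>R y) + q (z + t *\<^sub>R y) - (s + t) * q y"
      using q by (simp add: sublinear_def)
    finally show ?thesis by (simp add: algebra_simps)
  qed
  then have "shift q y (x + z) - shift q y z \<le> q (x + s *\<^sub>R y) - s * q y" if "0 \<le> s" for s
    using le_shift[of "shift q y (x + z) - (q (x + s *\<^sub>R y) - s * q y)" q z y] that by force
  then show "shift q y (x + z) \<le> shift q y x + shift q y z"
    using le_shift[of "shift q y (x + z) - shift q y z" q x y] by force
next
  fix c :: real and x assume c: "0 < c"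
  have "shift q y (c *\<^sub>R x) / c \<le> q (x + t *\<^sub>R y) - t * q y" if "0 \<le> t" for t
  proof -
    have "shift q y (c *\<^sub>R x) \<le> q (c *\<^sub>R (x + t *\<^sub>R y)) - c * t * q y"
      using shift_le[OF q, of "c * t" y "c *\<^sub>R x"] that c by (simp add: algebra_simps)
    also have "\<dots> = c * (q (x + t *\<^sub>R y) - t * q y)"
      using q c by (simp add: sublinear_def right_diff_distrib)
    finally show ?thesis using c by (simp add: field_simps)
  qed
  then have "shift q y (c *\<^sub>R x) / c \<le> shift q y x" by (rule le_shift)
  then show "shift q y (c *\<^sub>R x) \<le> c * shift q y x" using c by (simp add: field_simps)
next
  have "q (0 + t *\<^sub>R y) - t * q y = 0" if "t \<in> {0..}" for t
    using q that by (simp add: sublinear_def)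
  then show "shift q y 0 = 0" unfolding shift_def by simp
qed

(* A minimal sublinear functional coincides with all its shifts, so it is additive. *)
lemma ex_linear_le_sublinear:
  fixes p :: "'a::real_vector \<Rightarrow> real"
  assumes p: "sublinear p"
  shows "\<exists>f. linear f \<and> (\<forall>x. f x \<le> p x)"
proof -
  define A where "A = {q. sublinear q \<and> (\<forall>x. q x \<le> p x)}"
  \<comment> \<open>The order is reversed, so the maximal element supplied by Zorn's lemma is a
    minimal sublinear functional.\<close>
  define P where "P a b \<longleftrightarrow> (\<forall>x. b x \<le> a x)" for a b :: "'a \<Rightarrow> real"
  have "partial_order_on A (relation_of P A)"
    by (rule partial_order_on_relation_ofI) (auto simp: P_def intro: order_trans intro!: ext antisym)
  moreover have "\<exists>u\<in>A. \<forall>a\<in>C. P a u" if C: "C \<in> Chains (relation_of P A)" for C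
  proof (cases "C = {}")
    case True
    then show ?thesis using p by (auto simp: A_def)
  next
    case False
    have CA: "C \<subseteq> A" and tot: "\<And>a b. a \<in> C \<Longrightarrow> b \<in> C \<Longrightarrow> P a b \<or> P b a"
      using C by (auto simp: Chains_def relation_of_def)
    define u where "u x = (INF q\<in>C. q x)" for x
    \<comment> \<open>Since \<open>- q (- x) \<le> q x\<close>, the upper bound \<open>p\<close>
      also yields a lower bound, so the pointwise infimum over the chain is finite.\<close>
    have bdd: "bdd_below ((\<lambda>q. q x) ` C)" for x
    proof (rule bdd_belowI2[of _ "- p (- x)"])
      fix q assume "q \<in> C"
      then have "sublinear q" "q (- x) \<le> p (- x)" using CA by (auto simp: A_def)
      then show "- p (- x) \<le> q x" using sublinear_minus[of q x] by linarith
    qed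
    have le: "u x \<le> q x" if "q \<in> C" for q x
      unfolding u_def by (rule cINF_lower[OF bdd that])
    have ge: "c \<le> u x" if "\<And>q. q \<in> C \<Longrightarrow> c \<le> q x" for c x
      unfolding u_def using False that by (intro cINF_greatest) auto
    have "sublinear u"
    proof (rule sublinearI)
      fix x y
      \<comment> \<open>Comparability within the chain supplies one functional \<open>s\<close>
        below both \<open>q\<close> and \<open>r\<close>; an infimum over an arbitrary family need
        not be subadditive.\<close>
      have "u (x + y) - q x \<le> r y" if "q \<in> C" "r \<in> C" for q r
      proof -
        obtain s where s: "s \<in> C" "s x \<le> q x" "s y \<le> r y"
          using tot[OF \<open>q \<in> C\<close> \<open>r \<in> C\<close>] \<open>q \<in> C\<close> \<open>r \<in> C\<close> by (auto simp: P_def)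
        have "u (x + y) \<le> s (x + y)" by (rule le[OF s(1)])
        also have "\<dots> \<le> s x + s y" using s(1) CA by (auto simp: A_def sublinear_def)
        finally show ?thesis using s by simp
      qed
      then have "u (x + y) - u y \<le> q x" if "q \<in> C" for q
        using ge[of "u (x + y) - q x" y] that by force
      then show "u (x + y) \<le> u x + u y" using ge[of "u (x + y) - u y" x] by force
    next
      fix c :: real and x assume c: "0 < c"
      have "u (c *\<^sub>R x) / c \<le> q x" if "q \<in> C" for q
        using le[OF that, of "c *\<^sub>R x"] that CA c by (auto simp: A_def sublinear_def field_simps)
      then have "u (c *\<^sub>R x) / c \<le> u x" by (rule ge)
      then show "u (c *\<^sub>R x) \<le> c * u x" using c by (simp add: field_simps)
    next
      have "q 0 = 0" if "q \<in> C" for q using that CA by (auto simp: A_def sublinear_zero)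
      then have "(\<lambda>q. q 0) ` C = {0}" using False by (auto simp: image_iff)
      then show "u 0 = 0" by (simp add: u_def)
    qed
    moreover have "u x \<le> p x" for x
    proof -
      obtain q where "q \<in> C" using False by blast
      then show ?thesis using le[of q x] CA by (auto simp: A_def intro: order_trans)
    qed
    ultimately show ?thesis using le by (auto simp: A_def P_def intro!: bexI[of _ u])
  qed
  ultimately obtain m where m: "m \<in> A" and min: "\<And>a. a \<in> A \<Longrightarrow> P m a \<Longrightarrow> a = m"
    using predicate_Zorn[of A P] by blast
  have sub: "sublinear m" and mp: "\<And>x. m x \<le> p x" using m by (auto simp: A_def)
  have "shift m y = m" for y
  proof (rule min)
    have "shift m y x \<le> m x" for x using shift_le[OF sub, of 0 y x] by simp
    then show "shift m y \<in> A" "P m (shift m y)"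
      using sublinear_shift[OF sub] mp by (auto simp: A_def P_def intro: order_trans)
  qed
  then have "m x \<le> m (x + y) - m y" for x y using shift_le[OF sub, of 1 y x] by simp
  then have add: "m (x + y) = m x + m y" for x y
    using sub unfolding sublinear_def by (smt (verit))
  have "m (c *\<^sub>R x) = c * m x" for c x
  proof (cases "0 \<le> c")
    case True
    then show ?thesis using sub by (simp add: sublinear_def)
  next
    case False
    then have "m ((- c) *\<^sub>R x) = (- c) * m x" using sub by (simp add: sublinear_def del: scaleR_minus_left)
    then show ?thesis using add[of "c *\<^sub>R x" "- (c *\<^sub>R x)"] sublinear_zero[OF sub] by simp
  qed
  then have "linear m" using add by (intro linearI) auto
  then show ?thesis using mp by blast
qed

text \<open>Domination by \<open>shift norm z\<close> instead of the norm forces the value at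
  \<open>z\<close>: taking t = 1 shows that \<open>shift norm z (- z)\<close> is at most
  \<open>- norm z\<close>.\<close>

lemma ex_norming_functional_real:
  fixes z :: "'a::real_normed_vector"
  shows "\<exists>f. linear f \<and> (\<forall>x. \<bar>f x\<bar> \<le> norm x) \<and> f z = norm z"
proof -
  have n: "sublinear (norm :: 'a \<Rightarrow> real)" by (rule sublinearI) (auto simp: norm_triangle_ineq)
  obtain f where f: "linear f" "\<And>x. f x \<le> shift norm z x"
    using ex_linear_le_sublinear[OF sublinear_shift[OF n]] by blast
  have le: "f x \<le> norm x" for x
    using f(2)[of x] shift_le[OF n, of 0 z x] by simp
  have abs: "\<bar>f x\<bar> \<le> norm x" for x
    using le[of x] le[of "- x"] linear_neg[OF f(1), of x] by simp
  have "- f z \<le> - norm z"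
    using f(2)[of "- z"] shift_le[OF n, of 1 z "- z"] linear_neg[OF f(1), of z] by simp
  then show ?thesis using f(1) abs le[of z] by (intro exI[of _ f]) auto
qed

(* Over the real field j = 0, over the complex field j is the imaginary unit. *)
lemma rc_field_basis:
  obtains j :: "'k::rc_field" where "norm j \<le> 1"
    "\<And>a b. \<bar>a\<bar> \<le> norm (of_real a - j * of_real b)"
    "\<And>c. \<exists>a b. c = of_real a + of_real b * j \<and> (b = 0 \<or> j * j = -1)"
proof -
  obtain h :: "'k \<Rightarrow> complex" where add: "\<And>a b. h (a + b) = h a + h b"
    and mult: "\<And>a b. h (a * b) = h a * h b" and h_real: "\<And>r. h (r *\<^sub>R 1) = complex_of_real r"
    and h_norm: "\<And>a. cmod (h a) = norm a" and h_range: "range h = \<real> \<or> range h = UNIV"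
    using rc_embedding by metis
  have of_real: "h (of_real r) = of_real r" for r using h_real[of r] by (simp add: of_real_def)
  have diff: "h (a - b) = h a - h b" for a b using add[of "a - b" b] by simp
  have inj: "a = b" if "h a = h b" for a b
    using h_norm[of "a - b"] diff[of a b] that by simp
  show thesis
  proof (cases "range h = UNIV")
    case True
    then obtain j where j: "h j = \<i>" by (metis surjD)
    have jj: "j * j = -1"
      using of_real[of "-1"] by (intro inj) (simp add: mult j)
    show thesis
    proof (rule that[of j])
      show "norm j \<le> 1" using h_norm[of j] j by simp
      show "\<bar>a\<bar> \<le> norm (of_real a - j * of_real b)" for a b
        using abs_Re_le_cmod[of "of_real a - \<i> * of_real b"] h_norm[of "of_real a - j * of_real b"]
        by (simp add: diff mult of_real j)
      show "\<exists>a b. c = of_real a + of_real b * j \<and> (b = 0 \<or> j * j = -1)" for c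
        by (rule exI[of _ "Re (h c)"], rule exI[of _ "Im (h c)"])
          (auto simp: jj add mult of_real j complex_eq mult.commute intro!: inj)
    qed
  next
    case False
    then have r: "range h = \<real>" using h_range by blast
    show thesis
    proof (rule that[of 0])
      show "\<exists>a b. c = of_real a + of_real b * 0 \<and> (b = 0 \<or> 0 * 0 = (-1::'k))" for c :: 'k
      proof -
        have "h c \<in> \<real>" using r by blast
        then obtain a where "h c = of_real a" by (auto simp: Reals_def)
        then have "c = of_real a" by (intro inj) (simp add: of_real)
        then show ?thesis by (intro exI[of _ a] exI[of _ 0]) simp
      qed
    qed auto
  qed
qed

text \<open>The value at \<open>z\<close> is controlled from below because the real part of
  \<open>F z\<close> is \<open>l z\<close>. The bound 2 arises from estimating the two summands of
  \<open>F\<close> separately; it only enlarges later constants.\<close>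

lemma (in normed_space_over) ex_norming_functional:
  fixes z :: 'a
  obtains f where "f \<in> dual scale" "norm f \<le> 2" "norm z \<le> norm (blinfun_apply f z)"
proof -
  obtain j :: 'k where j: "norm j \<le> 1" and abs_le: "\<And>a b. \<bar>a\<bar> \<le> norm (of_real a - j * of_real b)"
    and basis: "\<And>c. \<exists>a b. c = of_real a + of_real b * j \<and> (b = 0 \<or> j * j = -1)"
    using rc_field_basis by blast
  obtain l where l: "linear l" "\<And>x. \<bar>l x\<bar> \<le> norm x" "l z = norm z"
    using ex_norming_functional_real[of z] by blast
  \<comment> \<open>The classical passage from a real functional l to the complex-linear functional
    l(x) - i l(ix); for j = 0 it gives back l.\<close>
  define F where "F x = of_real (l x) - j * of_real (l (scale j x))" for x
  have add: "F (x + y) = F x + F y" for x y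
    by (simp add: F_def linear_add[OF l(1)] scale_right_distrib algebra_simps)
  have real: "F (a *\<^sub>R x) = of_real a * F x" for a x
  proof -
    have "scale j (a *\<^sub>R x) = a *\<^sub>R scale j x"
      using scale_left_commute[of j "of_real a" x] unfolding scale_of_real .
    then show ?thesis by (simp add: F_def linear_cmul[OF l(1)] right_diff_distrib mult.left_commute)
  qed
  have imag: "F (scale j x) = j * F x" if "j * j = -1" for x
  proof -
    have "j * (j * a) = - a" for a using that by (metis mult.assoc mult_minus1)
    moreover have "scale j (scale j x) = - x"
      using scale_of_real[of "-1" x] that by simp
    ultimately show ?thesis
      by (simp add: F_def linear_neg[OF l(1)] right_diff_distrib)
  qed
  have scl: "F (scale c x) = c * F x" for c x
  proof -
    obtain a b where c: "c = of_real a + of_real b * j" "b = 0 \<or> j * j = -1" using basis by blast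
    have "scale c x = a *\<^sub>R x + b *\<^sub>R scale j x"
      unfolding c(1) by (simp add: scale_left_distrib scale_of_real flip: scale_scale)
    then show ?thesis
      using c imag by (auto simp: add real algebra_simps)
  qed
  have norm_F: "norm (F x) \<le> norm x * 2" for x
  proof -
    have "norm (F x) \<le> \<bar>l x\<bar> + norm j * \<bar>l (scale j x)\<bar>"
      unfolding F_def by (rule order_trans[OF norm_triangle_ineq4]) (simp add: norm_mult)
    also have "\<dots> \<le> norm x + 1 * norm x"
      using l(2)[of x] l(2)[of "scale j x"] j mult_right_mono[OF j, of "norm x"]
      by (intro add_mono mult_mono) (auto simp: norm_scale)
    finally show ?thesis by simp
  qed
  have bl: "bounded_linear F"
    by (rule bounded_linear_intro[of _ 2]) (auto simp: add real norm_F scaleR_conv_of_real)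
  show thesis
  proof (rule that[of "Blinfun F"])
    show "Blinfun F \<in> dual scale"
      using normed_space_over.axioms(1)[OF normed_space_over_field]
      by (simp add: operators_def Vector_Spaces.linear_iff bounded_linear_Blinfun_apply[OF bl] add scl
          vector_space_axioms)
    show "norm (Blinfun F) \<le> 2"
      by (rule norm_blinfun_bound) (use norm_F in \<open>auto simp: bounded_linear_Blinfun_apply[OF bl] mult.commute\<close>)
    show "norm z \<le> norm (blinfun_apply (Blinfun F) z)"
      using abs_le[of "l z" "l (scale j z)"] l(3) by (simp add: bounded_linear_Blinfun_apply[OF bl] F_def)
  qed
qed

section \<open>The p-hull of a sequence\<close>

(* The closed unit ball of the sequence space conjugate to l_p, described by duality. *)
definition dual_ball :: "real \<Rightarrow> (nat \<Rightarrow> 'a::real_normed_vector) \<Rightarrow> bool"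
  where "dual_ball p \<alpha> \<longleftrightarrow>
    (\<forall>N b. (\<forall>n. 0 \<le> b n) \<longrightarrow> (\<Sum>n<N. b n powr p) \<le> 1 \<longrightarrow> (\<Sum>n<N. norm (\<alpha> n) * b n) \<le> 1)"

lemma dual_ballD:
  "dual_ball p \<alpha> \<Longrightarrow> (\<And>n. 0 \<le> b n) \<Longrightarrow> (\<Sum>n<N. b n powr p) \<le> 1 \<Longrightarrow> (\<Sum>n<N. norm (\<alpha> n) * b n) \<le> 1"
  by (simp add: dual_ball_def)

lemma dual_ball_norm [simp]: "dual_ball p (\<lambda>n. norm (\<alpha> n)) = dual_ball p \<alpha>"
  by (simp add: dual_ball_def)

lemma dual_ball_zero [simp]: "dual_ball p (\<lambda>n. 0)"
  by (simp add: dual_ball_def)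

lemma dual_ball_coeff_le:
  assumes "dual_ball p \<alpha>" shows "norm (\<alpha> n) \<le> 1"
  using dual_ballD[OF assms, of "\<lambda>m. if m = n then 1 else 0" "Suc n"] by (simp add: if_distrib cong: if_cong)

text \<open>The ball is absolutely convex and solid, because membership only tests sums of
  \<open>norm (\<alpha> n)\<close> against nonnegative sequences.\<close>

lemma dual_ball_combination:
  fixes a :: "'i \<Rightarrow> nat \<Rightarrow> 'a::real_normed_vector"
  assumes c: "\<And>k. k \<in> I \<Longrightarrow> 0 \<le> c k" "(\<Sum>k\<in>I. c k) \<le> 1"
    and a: "\<And>k. k \<in> I \<Longrightarrow> dual_ball p (a k)"
    and le: "\<And>n. norm (\<beta> n) \<le> (\<Sum>k\<in>I. c k * norm (a k n))"
  shows "dual_ball p \<beta>"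
  unfolding dual_ball_def
proof (intro allI impI)
  fix N and b :: "nat \<Rightarrow> real" assume b: "\<forall>n. 0 \<le> b n" "(\<Sum>n<N. b n powr p) \<le> 1"
  have "(\<Sum>n<N. norm (\<beta> n) * b n) \<le> (\<Sum>n<N. (\<Sum>k\<in>I. c k * norm (a k n)) * b n)"
    using le b by (intro sum_mono mult_right_mono) auto
  also have "\<dots> = (\<Sum>k\<in>I. c k * (\<Sum>n<N. norm (a k n) * b n))"
    by (simp add: sum_distrib_left sum_distrib_right mult.assoc) (rule sum.swap)
  also have "\<dots> \<le> (\<Sum>k\<in>I. c k * 1)"
    using c a b by (intro sum_mono mult_left_mono dual_ballD) auto
  finally show "(\<Sum>n<N. norm (\<beta> n) * b n) \<le> 1" using c by simp
qed

text \<open>Each test involves finitely many coordinates, so it survives coordinatewise limits; this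
  is weak-star closedness of the ball.\<close>

lemma dual_ball_limit:
  assumes "\<And>k. dual_ball p (\<gamma> k)" "\<And>n. (\<lambda>k. \<gamma> k n) \<longlonglongrightarrow> l n"
  shows "dual_ball p l"
  unfolding dual_ball_def
proof (intro allI impI)
  fix N and b :: "nat \<Rightarrow> real" assume b: "\<forall>n. 0 \<le> b n" "(\<Sum>n<N. b n powr p) \<le> 1"
  have "(\<lambda>k. \<Sum>n<N. norm (\<gamma> k n) * b n) \<longlonglongrightarrow> (\<Sum>n<N. norm (l n) * b n)"
    by (intro tendsto_intros assms)
  then show "(\<Sum>n<N. norm (l n) * b n) \<le> 1"
    by (rule LIMSEQ_le_const2) (use b assms(1) in \<open>auto intro: dual_ballD\<close>)
qed

text \<open>Test sequences are bounded by 1, so their first \<open>M\<close> terms divided by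
  \<open>M\<close> add up to at most 1. The lemma serves to absorb finitely many uniformly small
  coefficients.\<close>

lemma dual_ball_initial_segment: "dual_ball p (\<lambda>n. if n < M then 1 / real M else 0)"
  if "1 \<le> p"
  unfolding dual_ball_def
proof (intro allI impI)
  fix N and b :: "nat \<Rightarrow> real" assume b: "\<forall>n. 0 \<le> b n" "(\<Sum>n<N. b n powr p) \<le> 1"
  have le1: "b n \<le> 1" if "n < N" for n
  proof -
    have "b n powr p \<le> (\<Sum>n<N. b n powr p)" using that by (intro member_le_sum) auto
    then have "b n powr p \<le> 1" using b by simp
    then show ?thesis using b \<open>1 \<le> p\<close> powr_le_one_imp_le_one[of "b n" p] by simp
  qed
  have "(\<Sum>n<N. norm (if n < M then 1 / real M else 0) * b n) \<le> (\<Sum>n<N. if n < M then 1 / real M else 0)"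
    using le1 b by (intro sum_mono) (auto simp: divide_simps)
  also have "\<dots> = (\<Sum>n\<in>{..<N} \<inter> {n. n < M}. 1 / real M)" by (subst sum.inter_restrict) auto
  also have "\<dots> \<le> (\<Sum>n<M. 1 / real M)" by (intro sum_mono2) auto
  also have "\<dots> \<le> 1" by simp
  finally show "(\<Sum>n<N. norm (if n < M then 1 / real M else 0) * b n) \<le> 1" .
qed

lemma dual_ball_holder:
  assumes "dual_ball p \<alpha>" "1 \<le> p" "\<And>n. 0 \<le> c n"
  shows "(\<Sum>n<N. norm (\<alpha> n) * c n) \<le> (\<Sum>n<N. c n powr p) powr (1/p)"
proof -
  define s where "s = (\<Sum>n<N. c n powr p) powr (1/p)"
  show ?thesis
  proof (cases "(\<Sum>n<N. c n powr p) = 0")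
    case True
    then have "\<And>n. n < N \<Longrightarrow> c n = 0" by (subst (asm) sum_nonneg_eq_0_iff) auto
    then show ?thesis by simp
  next
    case False
    moreover have "0 \<le> (\<Sum>n<N. c n powr p)" by (intro sum_nonneg) auto
    ultimately have pos: "0 < (\<Sum>n<N. c n powr p)" by linarith
    then have s: "0 < s" "s powr p = (\<Sum>n<N. c n powr p)"
      using assms(2) by (auto simp: s_def powr_powr)
    have "(\<Sum>n<N. (c n / s) powr p) = 1"
      using s pos assms(3) by (simp add: powr_divide flip: sum_divide_distrib)
    then have "(\<Sum>n<N. norm (\<alpha> n) * (c n / s)) \<le> 1"
      using assms s by (intro dual_ballD) auto
    then have "(\<Sum>n<N. norm (\<alpha> n) * c n) / s \<le> 1" by (simp add: sum_divide_distrib)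
    then show ?thesis using s by (simp add: s_def field_simps)
  qed
qed

text \<open>With r = p / (p - 1), the forward direction tests against
  \<open>norm (\<alpha> n) powr (r - 1)\<close>, whose p-th power is the r-th power of
  \<open>norm (\<alpha> n)\<close>. The backward direction is Young's inequality.\<close>

lemma dual_ball_iff_sum_powr:
  assumes p: "1 < p"
  shows "dual_ball p \<alpha> \<longleftrightarrow> (\<forall>N. (\<Sum>n<N. norm (\<alpha> n) powr (p / (p - 1))) \<le> 1)"
proof (intro iffI allI)
  fix N assume ball: "dual_ball p \<alpha>"
  define r where "r = p / (p - 1)"
  have r: "1 < r" using p by (simp add: r_def field_simps)
  have conj: "(r - 1) * p = r" "1 - 1/p = 1/r" using p by (auto simp: r_def field_simps)
  define A where "A = (\<Sum>n<N. norm (\<alpha> n) powr r)"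
  show "(\<Sum>n<N. norm (\<alpha> n) powr (p / (p - 1))) \<le> 1"
  proof (cases "A = 0")
    case False
    moreover have "0 \<le> A" unfolding A_def by (intro sum_nonneg) auto
    ultimately have A: "0 < A" by simp
    have "A = (\<Sum>n<N. norm (\<alpha> n) * norm (\<alpha> n) powr (r - 1))"
      unfolding A_def using r by (intro sum.cong refl) (auto simp: powr_diff)
    also have "\<dots> \<le> (\<Sum>n<N. (norm (\<alpha> n) powr (r - 1)) powr p) powr (1/p)"
      using p by (intro dual_ball_holder ball) auto
    also have "\<dots> = A powr (1/p)" by (simp add: powr_powr conj A_def)
    finally have "A powr (1 - 1/p) \<le> 1" using A by (simp add: powr_diff)
    then have "A \<le> 1" using A r powr_le_one_imp_le_one[of A "1/r"] unfolding conj by simp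
    then show ?thesis by (simp add: A_def r_def)
  qed (simp add: A_def r_def)
next
  assume sum_le: "\<forall>N. (\<Sum>n<N. norm (\<alpha> n) powr (p / (p - 1))) \<le> 1"
  define r where "r = p / (p - 1)"
  have r: "1 < r" "1/r + 1/p = 1" using p by (auto simp: r_def field_simps)
  show "dual_ball p \<alpha>"
    unfolding dual_ball_def
  proof (intro allI impI)
    fix N and b :: "nat \<Rightarrow> real" assume b: "\<forall>n. 0 \<le> b n" "(\<Sum>n<N. b n powr p) \<le> 1"
    have "(\<Sum>n<N. norm (\<alpha> n) * b n) \<le> (\<Sum>n<N. norm (\<alpha> n) powr r / r + b n powr p / p)"
      using r p b by (intro sum_mono Youngs_inequality) auto
    also have "\<dots> = (\<Sum>n<N. norm (\<alpha> n) powr r) / r + (\<Sum>n<N. b n powr p) / p"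
      by (simp add: sum.distrib sum_divide_distrib)
    also have "\<dots> \<le> 1 / r + 1 / p"
      using sum_le b r p unfolding r_def[symmetric] by (intro add_mono divide_right_mono) auto
    finally show "(\<Sum>n<N. norm (\<alpha> n) * b n) \<le> 1" using r by simp
  qed
qed

text \<open>Links the p-hull to \<open>dual_ball\<close>, which has one formula for
  \<open>p = 1\<close> and \<open>p > 1\<close>, although the conjugate index is infinite in the
  first case.\<close>

lemma lp_unit_ball_iff_dual_ball:
  assumes p: "1 \<le> p"
  shows "\<alpha> \<in> lp_space (conj_index (ereal p)) \<and> lp_norm (conj_index (ereal p)) \<alpha> \<le> 1 \<longleftrightarrow> dual_ball p \<alpha>"
proof (cases "p = 1")
  case True
  then have c: "conj_index (ereal p) = \<infinity>" by (simp add: conj_index_def one_ereal_def)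
  have "dual_ball 1 \<alpha> \<longleftrightarrow> (\<forall>n. norm (\<alpha> n) \<le> 1)"
  proof
    assume le: "\<forall>n. norm (\<alpha> n) \<le> 1"
    show "dual_ball 1 \<alpha>"
      unfolding dual_ball_def
    proof (intro allI impI)
      fix N and b :: "nat \<Rightarrow> real" assume b: "\<forall>n. 0 \<le> b n" "(\<Sum>n<N. b n powr 1) \<le> 1"
      have "(\<Sum>n<N. norm (\<alpha> n) * b n) \<le> (\<Sum>n<N. 1 * b n)"
        using le b by (intro sum_mono mult_right_mono) auto
      then show "(\<Sum>n<N. norm (\<alpha> n) * b n) \<le> 1" using b by simp
    qed
  qed (auto intro: dual_ball_coeff_le)
  moreover have "bounded (range \<alpha>) \<and> (SUP n. norm (\<alpha> n)) \<le> 1 \<longleftrightarrow> (\<forall>n. norm (\<alpha> n) \<le> 1)"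
  proof
    assume *: "bounded (range \<alpha>) \<and> (SUP n. norm (\<alpha> n)) \<le> 1"
    then have "bdd_above (range (\<lambda>n. norm (\<alpha> n)))" by (auto simp: bounded_iff bdd_above_def)
    then show "\<forall>n. norm (\<alpha> n) \<le> 1" using * by (meson UNIV_I cSUP_upper order_trans)
  next
    assume "\<forall>n. norm (\<alpha> n) \<le> 1"
    then show "bounded (range \<alpha>) \<and> (SUP n. norm (\<alpha> n)) \<le> 1"
      by (auto simp: bounded_iff intro!: cSUP_least)
  qed
  ultimately show ?thesis unfolding c using True by (simp add: lp_space_def lp_norm_def)
next
  case False
  then have p1: "1 < p" using p by simp
  define r where "r = p / (p - 1)"
  have r: "0 < r" using p1 by (simp add: r_def)
  have c: "conj_index (ereal p) = ereal r" using p1 by (simp add: conj_index_def one_ereal_def r_def)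
  let ?f = "\<lambda>n. norm (\<alpha> n) powr r"
  have "summable ?f \<and> suminf ?f powr (1/r) \<le> 1 \<longleftrightarrow> (\<forall>N. sum ?f {..<N} \<le> 1)"
  proof safe
    fix N assume s: "summable ?f" "suminf ?f powr (1/r) \<le> 1"
    have "suminf ?f \<le> 1"
      using powr_le_one_imp_le_one[OF s(2)] r suminf_nonneg[OF s(1)] by simp
    then show "sum ?f {..<N} \<le> 1" using sum_le_suminf[OF s(1), of "{..<N}"] by simp
  next
    assume le: "\<forall>N. sum ?f {..<N} \<le> 1"
    then show s: "summable ?f" by (intro summableI_nonneg_bounded[of _ 1]) auto
    have "suminf ?f \<le> 1" using le s by (intro suminf_le_const) auto
    then show "suminf ?f powr (1/r) \<le> 1"
      using r suminf_nonneg[OF s] powr_mono2[of "1/r" "suminf ?f" 1] by simp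
  qed
  then show ?thesis unfolding c dual_ball_iff_sum_powr[OF p1] r_def[symmetric]
    by (simp add: lp_space_def lp_norm_def)
qed

lemma p_hull_iff:
  "1 \<le> p \<Longrightarrow> y \<in> p_hull p sa x \<longleftrightarrow> (\<exists>\<alpha>. dual_ball p \<alpha> \<and> (\<lambda>n. sa (\<alpha> n) (x n)) sums y)"
  unfolding p_hull_def using lp_unit_ball_iff_dual_ball by blast

text \<open>Together with \<open>dual_ball_limit\<close> this is weak-star sequential compactness of
  the dual ball. The limit is found in the complex numbers, and closedness of the range of
  \<open>h\<close> brings it back to the field.\<close>

lemma rc_field_pointwise_subsequence:
  fixes \<gamma> :: "nat \<Rightarrow> nat \<Rightarrow> 'k::rc_field"
  assumes "\<And>k n. norm (\<gamma> k n) \<le> 1"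
  obtains \<sigma> l where "strict_mono (\<sigma> :: nat \<Rightarrow> nat)" "\<And>n. (\<lambda>k. \<gamma> (\<sigma> k) n) \<longlonglongrightarrow> l n"
proof -
  obtain h :: "'k \<Rightarrow> complex" where add: "\<And>a b. h (a + b) = h a + h b"
    and h_norm: "\<And>a. cmod (h a) = norm a" and h_range: "range h = \<real> \<or> range h = UNIV"
    using rc_embedding by metis
  have diff: "h (a - b) = h a - h b" for a b using add[of "a - b" b] by simp
  obtain \<sigma> where \<sigma>: "strict_mono (\<sigma> :: nat \<Rightarrow> nat)" "\<And>n. \<exists>l. (\<lambda>k. h (\<gamma> (\<sigma> k) n)) \<longlonglongrightarrow> l"
    using function_convergent_subsequence[of "UNIV :: nat set" "\<lambda>k n. h (\<gamma> k n)" 1] assms h_norm by auto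
  have "\<exists>l. (\<lambda>k. \<gamma> (\<sigma> k) n) \<longlonglongrightarrow> l" for n
  proof -
    obtain z where z: "(\<lambda>k. h (\<gamma> (\<sigma> k) n)) \<longlonglongrightarrow> z" using \<sigma>(2) by blast
    have "closed (range h)" using h_range closed_complex_Reals by auto
    from closed_sequentially[OF this _ z] have "z \<in> range h" by blast
    then obtain l where l: "z = h l" by auto
    have "(\<lambda>k. h (\<gamma> (\<sigma> k) n) - h l) \<longlonglongrightarrow> 0" using z l LIM_zero by blast
    then have "(\<lambda>k. norm (\<gamma> (\<sigma> k) n - l)) \<longlonglongrightarrow> 0"
      by (subst (asm) tendsto_norm_zero_iff[symmetric]) (simp add: h_norm flip: diff)
    then have "(\<lambda>k. \<gamma> (\<sigma> k) n) \<longlonglongrightarrow> l" using tendsto_norm_zero_iff LIM_zero_cancel by blast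
    then show ?thesis ..
  qed
  then show thesis using \<sigma>(1) that by metis
qed

lemma powr_tail_tendsto_zero:
  fixes f :: "nat \<Rightarrow> real"
  assumes "summable f" "\<And>n. 0 \<le> f n" "0 < s"
  shows "(\<lambda>M. (\<Sum>n. f (n + M)) powr s) \<longlonglongrightarrow> 0"
proof -
  have eq: "(\<Sum>n. f (n + M)) = suminf f - sum f {..<M}" for M
    using suminf_minus_initial_segment[OF assms(1)] .
  have "(\<lambda>M. suminf f - sum f {..<M}) \<longlonglongrightarrow> suminf f - suminf f"
    by (intro tendsto_intros summable_LIMSEQ assms)
  then have "(\<lambda>M. \<Sum>n. f (n + M)) \<longlonglongrightarrow> 0" by (simp add: eq)
  moreover have "0 \<le> (\<Sum>n. f (n + M))" for M
    using assms by (intro suminf_nonneg summable_ignore_initial_segment) auto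
  ultimately have "(\<lambda>M. (\<Sum>n. f (n + M)) powr s) \<longlonglongrightarrow> 0 powr s"
    using assms(3) by (intro tendsto_powr2 tendsto_const) auto
  then show ?thesis by simp
qed

section \<open>Tails and small differences in the p-hull\<close>

context normed_space_over
begin

text \<open>Hoelder's inequality on the tail gives a bound independent of \<open>\<alpha>\<close>;
  this uniformity allows a later passage to the limit in the coefficients.\<close>

lemma hull_tail_le:
  assumes p: "1 \<le> p" and x: "summable (\<lambda>n. norm (x n) powr p)" and \<alpha>: "dual_ball p \<alpha>"
    and sums: "(\<lambda>n. scale (\<alpha> n) (x n)) sums s"
  shows "norm ((\<Sum>n<M. scale (\<alpha> n) (x n)) - s) \<le> (\<Sum>n. norm (x (n + M)) powr p) powr (1/p)"
proof -
  let ?c = "\<lambda>n. if n < M then 0 else norm (x n)"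
  have "norm ((\<Sum>n<M. scale (\<alpha> n) (x n)) - (\<Sum>n<N. scale (\<alpha> n) (x n)))
      \<le> (\<Sum>n. norm (x (n + M)) powr p) powr (1/p)" if "M \<le> N" for N
  proof -
    have "norm ((\<Sum>n<M. scale (\<alpha> n) (x n)) - (\<Sum>n<N. scale (\<alpha> n) (x n))) = norm (\<Sum>n=M..<N. scale (\<alpha> n) (x n))"
      using sum_diff_nat_ivl[of 0 M N "\<lambda>n. scale (\<alpha> n) (x n)"] that
      by (subst norm_minus_commute) (simp add: atLeast0LessThan)
    also have "\<dots> \<le> (\<Sum>n=M..<N. norm (\<alpha> n) * norm (x n))"
      by (rule order_trans[OF norm_sum]) (simp add: norm_scale)
    also have "\<dots> = (\<Sum>n=M..<N. norm (\<alpha> n) * ?c n)" by (intro sum.cong) auto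
    also have "\<dots> \<le> (\<Sum>n<N. norm (\<alpha> n) * ?c n)" by (intro sum_mono2) auto
    also have "\<dots> \<le> (\<Sum>n<N. ?c n powr p) powr (1/p)" by (intro dual_ball_holder p \<alpha>) auto
    also have "(\<Sum>n<N. ?c n powr p) = (\<Sum>n\<in>{..<N} - {..<M}. norm (x n) powr p)"
      using p by (intro sum.mono_neutral_cong_right) auto
    also have "\<dots> = (\<Sum>n<N - M. norm (x (n + M)) powr p)"
      by (rule sum.reindex_bij_witness[of _ "\<lambda>n. n + M" "\<lambda>n. n - M"]) auto
    also have "(\<Sum>n<N - M. norm (x (n + M)) powr p) powr (1/p) \<le> (\<Sum>n. norm (x (n + M)) powr p) powr (1/p)"
      using p x summable_iff_shift[of "\<lambda>n. norm (x n) powr p" M]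
      by (intro powr_mono2 sum_le_suminf sum_nonneg) auto
    finally show ?thesis .
  qed
  moreover have "(\<lambda>N. norm ((\<Sum>n<M. scale (\<alpha> n) (x n)) - (\<Sum>n<N. scale (\<alpha> n) (x n)))) \<longlonglongrightarrow>
      norm ((\<Sum>n<M. scale (\<alpha> n) (x n)) - s)"
    using sums unfolding sums_def by (intro tendsto_intros)
  ultimately show ?thesis by (intro LIMSEQ_le_const2) auto
qed

(* By weak-star compactness, a small difference of points of the hull has a representation whose
   first M coefficients are small; the remaining ones only multiply the tail of x, which is small. *)
lemma p_hull_small_difference:
  assumes p: "1 \<le> p" and x: "x \<in> lp_space (ereal p)" and \<epsilon>: "0 < \<epsilon>"
  obtains \<delta> w where "0 < \<delta>" "w \<in> lp_space (ereal p)" "lp_norm (ereal p) w \<le> \<epsilon>"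
    "\<And>y y'. y \<in> p_hull p scale x \<Longrightarrow> y' \<in> p_hull p scale x \<Longrightarrow> norm (y - y') < \<delta> \<Longrightarrow> y - y' \<in> p_hull p scale w"
proof -
  interpret s: bounded_bilinear scale by (rule bounded_bilinear_scale)
  let ?f = "\<lambda>n. norm (x n) powr p"
  have sm: "summable ?f" using x by (simp add: lp_space_def)
  let ?T = "\<lambda>M. (\<Sum>n. norm (x (n + M)) powr p)"
  have T0: "(\<lambda>M. ?T M powr s) \<longlonglongrightarrow> 0" if "0 < s" for s
    using powr_tail_tendsto_zero[OF sm _ that] by simp
  have "0 \<le> suminf ?f" using sm by (intro suminf_nonneg) auto
  \<comment> \<open>Chosen so that the first block of \<open>w\<close> contributes at most half of
    \<open>\<epsilon> powr p\<close>; the summand 1 keeps the divisor positive.\<close>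
  define \<mu> where "\<mu> = \<epsilon> / (2 * (suminf ?f + 1)) powr (1/p)"
  have \<mu>: "0 < \<mu>" using \<epsilon> \<open>0 \<le> suminf ?f\<close> by (simp add: \<mu>_def)
  have \<mu>_le: "\<mu> powr p * suminf ?f \<le> \<epsilon> powr p / 2"
    using p \<epsilon> \<open>0 \<le> suminf ?f\<close> by (simp add: \<mu>_def powr_divide powr_powr field_simps)
  have "\<forall>\<^sub>F M in sequentially. ?T M powr 1 < \<epsilon> powr p / (2 * 8 powr p)"
    using \<epsilon> by (intro order_tendstoD(2)[OF T0]) auto
  then obtain M where "?T M powr 1 < \<epsilon> powr p / (2 * 8 powr p)"
    by (auto simp: eventually_sequentially)
  moreover have "0 \<le> ?T M" using sm by (intro suminf_nonneg summable_ignore_initial_segment) auto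
  ultimately have M: "8 powr p * ?T M \<le> \<epsilon> powr p / 2" by (simp add: field_simps)
  \<comment> \<open>The 8 turns the factor \<open>2 / m n\<close> of \<open>\<theta>\<close> below
    into 1/4 on the tail. The two quarters for \<open>\<gamma>\<close> and \<open>l\<close> and one
    half for the first \<open>M\<close> coefficients add up to 1.\<close>
  define m where "m n = (if n < M then \<mu> else 8)" for n
  have m: "0 < m n" for n using \<mu> by (simp add: m_def)
  define w where "w n = m n *\<^sub>R x n" for n
  have w_powr: "norm (w n) powr p = m n powr p * ?f n" for n
    using m[of n] by (simp add: w_def powr_mult)
  have w_tail: "norm (w (n + M)) powr p = 8 powr p * norm (x (n + M)) powr p" for n
    unfolding w_powr by (simp add: m_def)
  have sw: "summable (\<lambda>n. norm (w n) powr p)"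
    using sm by (subst summable_iff_shift[symmetric, of _ M])
      (auto simp: w_tail intro!: summable_mult summable_ignore_initial_segment)
  have "(\<Sum>n. norm (w n) powr p) = (\<Sum>n. norm (w (n + M)) powr p) + (\<Sum>n<M. norm (w n) powr p)"
    by (rule suminf_split_initial_segment[OF sw])
  also have "(\<Sum>n. norm (w (n + M)) powr p) = 8 powr p * ?T M"
    unfolding w_tail using sm by (intro suminf_mult summable_ignore_initial_segment)
  also have "(\<Sum>n<M. norm (w n) powr p) = \<mu> powr p * (\<Sum>n<M. ?f n)"
    by (simp add: w_powr m_def sum_distrib_left)
  also have "\<dots> \<le> \<mu> powr p * suminf ?f"
    using sm by (intro mult_left_mono sum_le_suminf) auto
  finally have w_le: "(\<Sum>n. norm (w n) powr p) \<le> \<epsilon> powr p" using M \<mu>_le by simp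
  have "lp_norm (ereal p) w \<le> (\<epsilon> powr p) powr (1/p)"
    unfolding lp_norm_def using w_le p sw by (auto intro!: powr_mono2 suminf_nonneg)
  then have norm_w: "lp_norm (ereal p) w \<le> \<epsilon>" using p \<epsilon> by (simp add: powr_powr)
  have "\<exists>\<delta>>0. \<forall>y y'. y \<in> p_hull p scale x \<longrightarrow> y' \<in> p_hull p scale x \<longrightarrow> norm (y - y') < \<delta> \<longrightarrow>
      y - y' \<in> p_hull p scale w"
  proof (rule ccontr)
    assume contra: "\<not> ?thesis"
    have "\<exists>z \<alpha> \<beta>. dual_ball p \<alpha> \<and> dual_ball p \<beta> \<and> (\<lambda>n. scale (\<alpha> n - \<beta> n) (x n)) sums z \<and>
        norm z < 1 / real (Suc k) \<and> z \<notin> p_hull p scale w" for k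
    proof -
      have "0 < 1 / real (Suc k)" by simp
      then obtain y y' where y: "y \<in> p_hull p scale x" "y' \<in> p_hull p scale x"
        "norm (y - y') < 1 / real (Suc k)" "y - y' \<notin> p_hull p scale w" using contra by blast
      then obtain \<alpha> \<beta> where "dual_ball p \<alpha>" "dual_ball p \<beta>"
        "(\<lambda>n. scale (\<alpha> n) (x n)) sums y" "(\<lambda>n. scale (\<beta> n) (x n)) sums y'"
        using p by (auto simp: p_hull_iff)
      then show ?thesis using y sums_diff[of "\<lambda>n. scale (\<alpha> n) (x n)" y "\<lambda>n. scale (\<beta> n) (x n)" y']
        by (intro exI[of _ "y - y'"] exI[of _ \<alpha>] exI[of _ \<beta>]) (simp add: scale_left_diff_distrib)
    qed
    then obtain z \<alpha> \<beta> where ab: "\<And>k. dual_ball p (\<alpha> k)" "\<And>k. dual_ball p (\<beta> k)"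
      and z: "\<And>k. (\<lambda>n. scale (\<alpha> k n - \<beta> k n) (x n)) sums z k" "\<And>k. norm (z k) < 1 / real (Suc k)"
        "\<And>k. z k \<notin> p_hull p scale w"
      by metis
    \<comment> \<open>Halved differences stay in the ball; the half is undone by the 2 in
      \<open>\<theta>\<close>.\<close>
    define \<gamma> where "\<gamma> k n = (1/2) *\<^sub>R (\<alpha> k n - \<beta> k n)" for k n
    have \<gamma>: "dual_ball p (\<gamma> k)" for k
    proof (rule dual_ball_combination[of "UNIV :: bool set" "\<lambda>_. 1/2" p "\<lambda>c. if c then \<alpha> k else \<beta> k"])
      fix n
      show "norm (\<gamma> k n) \<le> (\<Sum>c\<in>UNIV. 1/2 * norm ((if c then \<alpha> k else \<beta> k) n))"
        using norm_triangle_ineq4[of "\<alpha> k n" "\<beta> k n"] by (simp add: \<gamma>_def UNIV_bool)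
    qed (use ab in \<open>auto simp: UNIV_bool\<close>)
    have \<gamma>_sums: "(\<lambda>n. scale (\<gamma> k n) (x n)) sums ((1/2) *\<^sub>R z k)" for k
      using sums_scaleR_right[OF z(1)[of k], of "1/2"] by (simp add: \<gamma>_def s.scaleR_left)
    obtain \<sigma> l where \<sigma>: "strict_mono (\<sigma> :: nat \<Rightarrow> nat)" and l: "\<And>n. (\<lambda>k. \<gamma> (\<sigma> k) n) \<longlonglongrightarrow> l n"
      using rc_field_pointwise_subsequence[of \<gamma>] dual_ball_coeff_le[OF \<gamma>] by blast
    have l_ball: "dual_ball p l" by (rule dual_ball_limit[of p "\<lambda>k. \<gamma> (\<sigma> k)"]) (auto intro: \<gamma> l)
    have "z \<longlonglongrightarrow> 0"
      using z(2) by (intro Lim_null_comparison[OF _ LIMSEQ_inverse_real_of_nat])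
        (auto intro!: always_eventually less_imp_le simp: inverse_eq_divide)
    then have z0: "(\<lambda>k. z (\<sigma> k)) \<longlonglongrightarrow> 0" using LIMSEQ_subseq_LIMSEQ[OF _ \<sigma>] by (auto simp: o_def)
    \<comment> \<open>First k tends to infinity for fixed \<open>j\<close>, then \<open>j\<close>
      does. The limit coefficients \<open>l\<close> therefore represent 0, and subtracting multiples
      of them changes the coefficients of a point but not the point.\<close>
    have "norm (\<Sum>n<j. scale (l n) (x n)) \<le> ?T j powr (1/p)" for j
    proof -
      have "(\<lambda>k. norm ((\<Sum>n<j. scale (\<gamma> (\<sigma> k) n) (x n)) - (1/2) *\<^sub>R z (\<sigma> k))) \<longlonglongrightarrow>
          norm ((\<Sum>n<j. scale (l n) (x n)) - (1/2) *\<^sub>R 0)"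
        by (intro tendsto_intros z0 s.tendsto l)
      then show ?thesis
        by (intro LIMSEQ_le_const2[of _ "norm (\<Sum>n<j. scale (l n) (x n))"]) (auto intro!: hull_tail_le p sm \<gamma> \<gamma>_sums)
    qed
    then have "(\<lambda>j. \<Sum>n<j. scale (l n) (x n)) \<longlonglongrightarrow> 0"
      using p by (intro Lim_null_comparison[OF always_eventually T0[of "1/p"]]) auto
    then have l_sums: "(\<lambda>n. scale (l n) (x n)) sums 0" by (simp add: sums_def)
    \<comment> \<open>Multiplied by \<open>2 / \<mu>\<close>, this tolerance becomes half of 1 / M,
      the value in \<open>dual_ball_initial_segment\<close>.\<close>
    have "\<forall>\<^sub>F k in sequentially. \<forall>n\<in>{..<M}. norm (\<gamma> (\<sigma> k) n - l n) < \<mu> / (4 * M)"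
    proof (intro eventually_ball_finite ballI)
      fix n assume "n \<in> {..<M}"
      then have "0 < \<mu> / (4 * M)" using \<mu> by simp
      then show "\<forall>\<^sub>F k in sequentially. norm (\<gamma> (\<sigma> k) n - l n) < \<mu> / (4 * M)"
        using l[of n] by (auto simp: tendsto_iff dist_norm)
    qed simp
    then obtain k where k: "\<And>n. n < M \<Longrightarrow> norm (\<gamma> (\<sigma> k) n - l n) < \<mu> / (4 * M)"
      by (auto simp: eventually_sequentially)
    define \<theta> where "\<theta> n = (2 / m n) *\<^sub>R (\<gamma> (\<sigma> k) n - l n)" for n
    have "dual_ball p \<theta>"
    proof (rule dual_ball_combination[of "{..<3::nat}" "\<lambda>i. if i = 0 then 1/2 else 1/4" p
          "\<lambda>i. if i = 0 then (\<lambda>n. if n < M then 1 / real M else 0) else if i = 1 then (\<lambda>n. norm (\<gamma> (\<sigma> k) n))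
            else (\<lambda>n. norm (l n))"])
      fix n
      have "norm (\<theta> n) \<le> 1/2 * (if n < M then 1 / real M else 0) + 1/4 * norm (\<gamma> (\<sigma> k) n) + 1/4 * norm (l n)"
      proof (cases "n < M")
        case True
        then have "norm (\<theta> n) = 2 / \<mu> * norm (\<gamma> (\<sigma> k) n - l n)"
          using \<mu> by (simp add: \<theta>_def m_def)
        also have "\<dots> \<le> 2 / \<mu> * (\<mu> / (4 * M))"
          using k[OF True] \<mu> by (intro mult_left_mono) auto
        also have "\<dots> = 1/2 * (1 / real M)" using \<mu> by simp
        finally show ?thesis using True by (simp add: add_increasing2)
      next
        case False
        then show ?thesis using norm_triangle_ineq4[of "\<gamma> (\<sigma> k) n" "l n"] by (simp add: \<theta>_def m_def)
      qed
      then show "norm (\<theta> n) \<le> (\<Sum>i\<in>{..<3::nat}. (if i = 0 then 1/2 else 1/4) * norm ((if i = 0 then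
          (\<lambda>n. if n < M then 1 / real M else 0) else if i = 1 then (\<lambda>n. norm (\<gamma> (\<sigma> k) n))
            else (\<lambda>n. norm (l n))) n))"
        by (simp add: numeral_3_eq_3)
    qed (use \<gamma> l_ball dual_ball_initial_segment[OF p, of M] in \<open>auto simp: numeral_3_eq_3\<close>)
    moreover have "scale (\<theta> n) (w n) = scale (\<alpha> (\<sigma> k) n - \<beta> (\<sigma> k) n) (x n) - 2 *\<^sub>R scale (l n) (x n)" for n
    proof -
      have "scale (\<theta> n) (w n) = (2 / m n * m n) *\<^sub>R scale (\<gamma> (\<sigma> k) n - l n) (x n)"
        by (simp add: \<theta>_def w_def s.scaleR_left s.scaleR_right)
      also have "2 / m n * m n = 2" using m[of n] by simp
      finally show ?thesis by (simp add: s.diff_left scaleR_diff_right \<gamma>_def s.scaleR_left)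
    qed
    then have "(\<lambda>n. scale (\<theta> n) (w n)) sums z (\<sigma> k)"
      using sums_diff[OF z(1)[of "\<sigma> k"] sums_scaleR_right[OF l_sums, of 2]] by simp
    ultimately have "z (\<sigma> k) \<in> p_hull p scale w" using p by (auto simp: p_hull_iff)
    then show False using z(3) by blast
  qed
  moreover have "w \<in> lp_space (ereal p)" using sw by (simp add: lp_space_def)
  ultimately show thesis using that norm_w by blast
qed

end

section \<open>Riemann sums over fine partitions of unity\<close>

lemma apply_Bcontfun_compact:
  fixes f :: "'w::topological_space \<Rightarrow> 'a::real_normed_vector"
  assumes "compact (UNIV :: 'w set)" "continuous_on UNIV f"
  shows "apply_bcontfun (Bcontfun f) = f"
  using assms compact_continuous_image[OF assms(2,1)]
  by (auto simp: bcontfun_def intro!: Bcontfun_inverse compact_imp_bounded)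

text \<open>A point of the finite set is at once the index of a partition function and the place
  where \<open>f\<close> is sampled, so a Riemann sum needs no further data.\<close>

definition fine_partition ::
  "('w::topological_space \<Rightarrow>\<^sub>C 'a::real_normed_vector) \<Rightarrow> real \<Rightarrow> 'w set \<times> ('w \<Rightarrow> 'w \<Rightarrow> real) \<Rightarrow> bool"
  where "fine_partition f \<delta> P \<longleftrightarrow> finite (fst P) \<and>
    (\<forall>a\<in>fst P. continuous_on UNIV (snd P a) \<and> (\<forall>w. 0 \<le> snd P a w)) \<and>
    (\<forall>w. (\<Sum>a\<in>fst P. snd P a w) = 1) \<and>
    (\<forall>a\<in>fst P. \<forall>w. snd P a w \<noteq> 0 \<longrightarrow> norm (apply_bcontfun f w - apply_bcontfun f a) < \<delta>)"

text \<open>The bump functions are made from the given functions: \<open>d\<close> adds up their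
  relative variations, so \<open>d a w < 1\<close> enforces every tolerance at once. Compactness
  selects finitely many centres, and division by the sum of the bumps normalises.\<close>

lemma ex_fine_partition:
  fixes X :: "(('w::topological_space \<Rightarrow>\<^sub>C 'a::real_normed_vector) \<times> real) set"
  assumes comp: "compact (UNIV :: 'w set)" and X: "finite X" "\<And>f \<delta>. (f, \<delta>) \<in> X \<Longrightarrow> 0 < \<delta>"
  shows "\<exists>P. \<forall>(f, \<delta>)\<in>X. fine_partition f \<delta> P"
proof -
  define d where "d a w = (\<Sum>(f, \<delta>)\<in>X. norm (apply_bcontfun f w - apply_bcontfun f a) / \<delta>)" for a w
  have d_cont: "continuous_on UNIV (d a)" for a
    unfolding d_def case_prod_beta using X(2)
    by (intro continuous_intros) force+
  have d_less: "norm (apply_bcontfun f w - apply_bcontfun f a) < \<delta>" if "(f, \<delta>) \<in> X" "d a w < 1" for f \<delta> a w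
  proof -
    have "norm (apply_bcontfun f w - apply_bcontfun f a) / \<delta> \<le> d a w"
      unfolding d_def using that X member_le_sum[of "(f, \<delta>)" X "\<lambda>(f, \<delta>). norm (apply_bcontfun f w - apply_bcontfun f a) / \<delta>"]
      by (fastforce intro: less_imp_le)
    then show ?thesis using that X(2)[OF that(1)] by (auto simp: field_simps intro: order_le_less_trans)
  qed
  have "open {w. d a w < 1}" for a using d_cont by (intro open_Collect_less continuous_intros)
  moreover have "UNIV \<subseteq> (\<Union>a\<in>UNIV. {w. d a w < 1})"
  proof
    fix w :: 'w
    have "d w w < 1" by (simp add: d_def case_prod_beta)
    then show "w \<in> (\<Union>a\<in>UNIV. {w. d a w < 1})" by blast
  qed
  ultimately obtain A where A: "finite A" "UNIV \<subseteq> (\<Union>a\<in>A. {w. d a w < 1})"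
    using compactE_image[OF comp, of UNIV "\<lambda>a. {w. d a w < 1}"] by metis
  define g where "g a w = max 0 (1 - d a w)" for a w
  have g_cont: "continuous_on UNIV (g a)" for a unfolding g_def by (intro continuous_intros d_cont)
  define G where "G w = (\<Sum>a\<in>A. g a w)" for w
  have G_pos: "0 < G w" for w
  proof -
    obtain a where "a \<in> A" "d a w < 1" using A(2) by blast
    then show ?thesis unfolding G_def using A(1) by (intro sum_pos2[of A a]) (auto simp: g_def)
  qed
  have "fine_partition f \<delta> (A, \<lambda>a w. g a w / G w)" if "(f, \<delta>) \<in> X" for f \<delta>
    unfolding fine_partition_def fst_conv snd_conv
  proof (intro conjI ballI allI impI A(1))
    fix a w
    have "continuous_on UNIV G" unfolding G_def by (intro continuous_intros g_cont)
    then show "continuous_on UNIV (\<lambda>w. g a w / G w)"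
      using G_pos by (intro continuous_intros g_cont) (auto simp: less_imp_neq[symmetric])
    show "0 \<le> g a w / G w" using G_pos[of w] by (simp add: g_def)
    show "(\<Sum>a\<in>A. g a w / G w) = 1"
      using G_pos[of w] by (simp add: G_def flip: sum_divide_distrib)
    assume "g a w / G w \<noteq> 0"
    then have "d a w < 1" by (auto simp: g_def max_def split: if_splits)
    then show "norm (apply_bcontfun f w - apply_bcontfun f a) < \<delta>" by (rule d_less[OF that])
  qed
  then show ?thesis by blast
qed

text \<open>One filter for all functions and tolerances, so that the limits for f, g and f + g are
  taken along the same partitions. The \<open>itself\<close> argument fixes the value type, which
  does not occur in the result type.\<close>

definition fine_filter :: "('w::topological_space \<Rightarrow>\<^sub>C 'a::real_normed_vector) itself \<Rightarrow> ('w set \<times> ('w \<Rightarrow> 'w \<Rightarrow> real)) filter"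
  where "fine_filter t =
    (INF i\<in>(UNIV :: ('w \<Rightarrow>\<^sub>C 'a) set) \<times> {0<..}. principal {P. fine_partition (fst i) (snd i) P})"

lemma eventually_fine_partition:
  fixes f :: "'w::topological_space \<Rightarrow>\<^sub>C 'a::real_normed_vector"
  assumes "0 < \<delta>"
  shows "eventually (fine_partition f \<delta>) (fine_filter TYPE('w \<Rightarrow>\<^sub>C 'a))"
  unfolding fine_filter_def
  by (rule eventually_INF1[of "(f, \<delta>)"]) (use assms in \<open>auto simp: eventually_principal\<close>)

lemma fine_filter_neq_bot:
  assumes "compact (UNIV :: 'w::topological_space set)"
  shows "fine_filter TYPE('w \<Rightarrow>\<^sub>C 'a::real_normed_vector) \<noteq> bot"
  unfolding trivial_limit_def fine_filter_def
proof (subst eventually_INF, safe)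
  fix X :: "(('w \<Rightarrow>\<^sub>C 'a) \<times> real) set"
  assume X: "X \<subseteq> UNIV \<times> {0<..}" "finite X"
    and "eventually (\<lambda>P. False) (INF i\<in>X. principal {P. fine_partition (fst i) (snd i) P})"
  then have "(\<Inter>i\<in>X. {P. fine_partition (fst i) (snd i) P}) = {}"
    by (auto simp: INF_principal_finite eventually_principal)
  moreover obtain P where P: "\<forall>(f, \<delta>)\<in>X. fine_partition f \<delta> P"
    using ex_fine_partition[OF assms X(2)] X(1) by auto
  from P have "P \<in> (\<Inter>i\<in>X. {P. fine_partition (fst i) (snd i) P})" by (auto simp: case_prod_beta)
  ultimately show False by simp
qed

section \<open>Operators on C(Omega) and their bound on elementary tensors\<close>

locale operator_on_C =
  X: normed_space_over sx + Y: normed_space_over sy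
  for sx :: "'k::rc_field \<Rightarrow> 'x::banach \<Rightarrow> 'x" and sy :: "'k \<Rightarrow> 'y::banach \<Rightarrow> 'y" +
  fixes S :: "('w::t2_space \<Rightarrow>\<^sub>C 'k) \<Rightarrow>\<^sub>L ('x \<Rightarrow>\<^sub>L 'y)"
  assumes compact_domain: "compact (UNIV :: 'w set)"
    and S_operator: "S \<in> operators (scale_bcontfun (*)) (scale_blinfun sy)"
    and S_range: "range (blinfun_apply S) \<subseteq> operators sx sy"
begin

text \<open>\<open>S\<close> transported to plain functions, so that arguments can be written
  pointwise. Only continuous arguments are meaningful, as \<open>Bcontfun\<close> is unspecified
  elsewhere; hence the continuity hypotheses below.\<close>

definition T :: "('w \<Rightarrow> 'k) \<Rightarrow> ('x \<Rightarrow>\<^sub>L 'y)"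
  where "T f = blinfun_apply S (Bcontfun f)"

lemmas apply_Bcontfun = apply_Bcontfun_compact[OF compact_domain]

lemma T_apply_bcontfun: "T (apply_bcontfun \<phi>) = blinfun_apply S \<phi>"
  by (simp add: T_def apply_bcontfun_inverse)

lemma T_add:
  assumes "continuous_on UNIV f" "continuous_on UNIV g"
  shows "T (\<lambda>w. f w + g w) = T f + T g"
proof -
  have "Bcontfun (\<lambda>w. f w + g w) = Bcontfun f + Bcontfun g"
    using assms by (intro bcontfun_eqI) (simp add: apply_Bcontfun continuous_intros)
  then show ?thesis by (simp add: T_def blinfun.add_right)
qed

lemma T_scaleR:
  assumes "continuous_on UNIV f"
  shows "T (\<lambda>w. c *\<^sub>R f w) = c *\<^sub>R T f"
proof -
  have "Bcontfun (\<lambda>w. c *\<^sub>R f w) = c *\<^sub>R Bcontfun f"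
    using assms by (intro bcontfun_eqI) (simp add: apply_Bcontfun continuous_intros)
  then show ?thesis by (simp add: T_def blinfun.scaleR_right)
qed

lemma T_mult_const:
  assumes "continuous_on UNIV f"
  shows "blinfun_apply (T (\<lambda>w. c * f w)) x = sy c (blinfun_apply (T f) x)"
proof -
  interpret K: normed_space_over "(*) :: 'k \<Rightarrow> 'k \<Rightarrow> 'k" by (rule normed_space_over_field)
  have "Bcontfun (\<lambda>w. c * f w) = scale_bcontfun (*) c (Bcontfun f)"
    using assms by (intro bcontfun_eqI) (simp add: apply_Bcontfun continuous_intros K.scale_bcontfun_apply)
  then show ?thesis
    using S_operator by (simp add: T_def operators_def Vector_Spaces.linear_iff Y.scale_blinfun_apply)
qed

lemma T_zero: "T (\<lambda>w. 0) = 0"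
  using T_scaleR[of "\<lambda>w. 0" 0] by simp

lemma T_sum:
  assumes "finite I" "\<And>i. i \<in> I \<Longrightarrow> continuous_on UNIV (f i)"
  shows "T (\<lambda>w. \<Sum>i\<in>I. f i w) = (\<Sum>i\<in>I. T (f i))"
  using assms
  by (induction I rule: finite_induct) (auto simp: T_zero T_add continuous_on_sum)

lemma norm_T_le:
  assumes "continuous_on UNIV f" "\<And>w. norm (f w) \<le> c"
  shows "norm (T f) \<le> norm S * c"
proof -
  have "norm (Bcontfun f) \<le> c"
    using assms by (intro norm_bound) (simp add: apply_Bcontfun)
  then show ?thesis
    unfolding T_def by (intro order_trans[OF norm_blinfun] mult_left_mono) auto
qed

lemma T_scale: "blinfun_apply (T f) (sx c x) = sy c (blinfun_apply (T f) x)"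
  using subsetD[OF S_range rangeI[of "blinfun_apply S" "Bcontfun f"]]
  by (simp add: T_def operators_def Vector_Spaces.linear_iff)

lemma tensor_bound_1:
  assumes "\<And>n. n < N \<Longrightarrow> continuous_on UNIV (\<phi> n)"
    and "\<And>w. dual_ball 1 (\<lambda>n. if n < N then \<phi> n w else 0)"
  shows "norm (\<Sum>n<N. blinfun_apply (T (\<phi> n)) (v n)) \<le> norm S * (\<Sum>n<N. norm (v n) powr 1) powr (1/1)"
proof -
  have "norm (T (\<phi> n)) \<le> norm S * 1" if "n < N" for n
    using dual_ball_coeff_le[OF assms(2), of n] that by (intro norm_T_le assms(1)) auto
  then have "norm (blinfun_apply (T (\<phi> n)) (v n)) \<le> norm S * norm (v n)" if "n < N" for n
    using that by (intro order_trans[OF norm_blinfun] mult_right_mono) auto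
  then have "norm (\<Sum>n<N. blinfun_apply (T (\<phi> n)) (v n)) \<le> (\<Sum>n<N. norm S * norm (v n))"
    by (intro sum_norm_le) auto
  then show ?thesis by (simp add: sum_distrib_left sum_nonneg)
qed

lemma functional_T_in_dual:
  assumes "y \<in> dual sy"
  shows "y o\<^sub>L T f \<in> dual sx"
  using assms T_scale[of f] X.vector_space_axioms normed_space_over.axioms(1)[OF normed_space_over_field]
  by (simp add: operators_def Vector_Spaces.linear_iff blinfun.add_right)

(* A sum of signed images is the image of a signed sum of functions, so cotype bounds the l_q-norm
   of the images by the supremum of the sum of the absolute values of the functions. *)
lemma summing_seminorm_functional_T:
  assumes q: "2 \<le> q" and cotype: "\<And>n v. v \<in> {..<n} \<rightarrow> dual sx \<Longrightarrow>
      (\<Sum>i<n. norm (v i) powr q) powr (1 / q)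
         \<le> C * sqrt ((\<Sum>e\<in>{..<n} \<rightarrow>\<^sub>E {-1, 1}. (norm (\<Sum>i<n. e i *\<^sub>R v i))\<^sup>2) / 2 ^ n)"
    and y: "y \<in> dual sy" "norm y \<le> 2"
  defines "B \<equiv> 2 * norm S + 1"
  shows "summing_seminorm (\<lambda>f. norm (y o\<^sub>L T f)) B ((\<bar>C\<bar> * B) powr q) q"
proof
  have bound: "norm (y o\<^sub>L T f) \<le> B" if "continuous_on UNIV f" "\<And>w. norm (f w) \<le> 1" for f
  proof -
    have "norm (y o\<^sub>L T f) \<le> norm y * norm (T f)" by (rule norm_blinfun_compose)
    also have "\<dots> \<le> 2 * (norm S * 1)" using y(2) that by (intro mult_mono norm_T_le) auto
    finally show ?thesis by (simp add: B_def)
  qed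
  show "0 < B" by (simp add: B_def add_nonneg_pos)
  show "1 \<le> q" using q by simp
  show "0 \<le> (\<bar>C\<bar> * B) powr q" by simp
  show "norm (y o\<^sub>L T (\<lambda>w. f w + g w)) \<le> norm (y o\<^sub>L T f) + norm (y o\<^sub>L T g)"
    if "continuous_on UNIV f" "continuous_on UNIV g" for f g
    using that norm_triangle_ineq by (simp add: T_add bounded_bilinear.add_right[OF bounded_bilinear_blinfun_compose])
  show "norm (y o\<^sub>L T (\<lambda>w. c *\<^sub>R f w)) = \<bar>c\<bar> * norm (y o\<^sub>L T f)"
    if "continuous_on UNIV f" for f c
    using that by (simp add: T_scaleR bounded_bilinear.scaleR_right[OF bounded_bilinear_blinfun_compose])
  show "norm (y o\<^sub>L T f) \<le> B" if "continuous_on UNIV f" "\<And>w. norm (f w) \<le> 1" for f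
    using bound that .
  fix n :: nat and f :: "nat \<Rightarrow> 'w \<Rightarrow> 'k"
  assume f: "\<And>i. i < n \<Longrightarrow> continuous_on UNIV (f i)" and le: "\<And>w. (\<Sum>i<n. norm (f i w)) \<le> 1"
  have signed: "(norm (\<Sum>i<n. e i *\<^sub>R (y o\<^sub>L T (f i))))\<^sup>2 \<le> B\<^sup>2" if "e \<in> {..<n} \<rightarrow>\<^sub>E {-1, 1}" for e
  proof -
    have e: "\<bar>e i\<bar> = 1" if "i < n" for i
      using PiE_mem[OF \<open>e \<in> {..<n} \<rightarrow>\<^sub>E {-1, 1}\<close>, of i] that by auto
    have "T (\<lambda>w. \<Sum>i<n. e i *\<^sub>R f i w) = (\<Sum>i<n. e i *\<^sub>R T (f i))"
      using f by (subst T_sum) (auto intro!: continuous_intros sum.cong T_scaleR)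
    then have "(\<Sum>i<n. e i *\<^sub>R (y o\<^sub>L T (f i))) = y o\<^sub>L T (\<lambda>w. \<Sum>i<n. e i *\<^sub>R f i w)"
      by (simp add: bounded_bilinear.sum_right[OF bounded_bilinear_blinfun_compose]
          bounded_bilinear.scaleR_right[OF bounded_bilinear_blinfun_compose])
    moreover have "norm (\<Sum>i<n. e i *\<^sub>R f i w) \<le> 1" for w
      using order_trans[OF norm_sum, of "\<lambda>i. e i *\<^sub>R f i w" "{..<n}" 1] le[of w] e by simp
    ultimately have "norm (\<Sum>i<n. e i *\<^sub>R (y o\<^sub>L T (f i))) \<le> B"
      using f by (auto intro!: bound continuous_intros)
    then show ?thesis by (intro power_mono) auto
  qed
  have "(\<Sum>e\<in>{..<n} \<rightarrow>\<^sub>E {-1, 1::real}. (norm (\<Sum>i<n. e i *\<^sub>R (y o\<^sub>L T (f i))))\<^sup>2)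
      \<le> (\<Sum>e\<in>{..<n} \<rightarrow>\<^sub>E {-1, 1::real}. B\<^sup>2)"
    using signed by (intro sum_mono) auto
  also have "\<dots> = 2 ^ n * B\<^sup>2" by (simp add: card_PiE)
  finally have "(\<Sum>e\<in>{..<n} \<rightarrow>\<^sub>E {-1, 1::real}. (norm (\<Sum>i<n. e i *\<^sub>R (y o\<^sub>L T (f i))))\<^sup>2) / 2 ^ n \<le> B\<^sup>2"
    by (simp add: field_simps)
  then have sqrt_le: "sqrt ((\<Sum>e\<in>{..<n} \<rightarrow>\<^sub>E {-1, 1::real}. (norm (\<Sum>i<n. e i *\<^sub>R (y o\<^sub>L T (f i))))\<^sup>2) / 2 ^ n) \<le> B"
    by (intro real_le_lsqrt) (auto simp: B_def)
  have "(\<Sum>i<n. norm (y o\<^sub>L T (f i)) powr q) powr (1 / q)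
      \<le> C * sqrt ((\<Sum>e\<in>{..<n} \<rightarrow>\<^sub>E {-1, 1}. (norm (\<Sum>i<n. e i *\<^sub>R (y o\<^sub>L T (f i))))\<^sup>2) / 2 ^ n)"
    using functional_T_in_dual[OF y(1)] by (intro cotype) auto
  also have "\<dots> \<le> \<bar>C\<bar> * B"
    using abs_ge_self sqrt_le abs_ge_zero
    by (rule mult_mono) (intro real_sqrt_ge_zero divide_nonneg_nonneg sum_nonneg zero_le_power2 zero_le_power, simp)
  finally have "((\<Sum>i<n. norm (y o\<^sub>L T (f i)) powr q) powr (1 / q)) powr q \<le> (\<bar>C\<bar> * B) powr q"
    using q by (intro powr_mono2) auto
  then show "(\<Sum>i<n. norm (y o\<^sub>L T (f i)) powr q) \<le> (\<bar>C\<bar> * B) powr q"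
    using q by (simp add: powr_powr sum_nonneg)
qed

text \<open>This is boundedness for the tensor norm d_p, since the weak l_p'-norm of functions in
  C(Omega) is the supremum over \<open>w\<close> of the l_p'-norm of their values. For p > 1 a
  functional norming the sum is inserted, and Hoelder's inequality pairs the r-summable norms of
  \<open>y o\<^sub>L T (\<phi> n)\<close>, where r = p', with the norms of \<open>v n\<close>. The
  constant does not depend on the functional.\<close>

lemma tensor_bound:
  assumes q: "2 \<le> q" and cotype: "has_cotype (dual sx) q" and p: "1 \<le> p" "ereal p < conj_index (ereal q)"
  obtains D where "0 < D" "\<And>N \<phi> v. (\<And>n. n < N \<Longrightarrow> continuous_on UNIV (\<phi> n)) \<Longrightarrow>
    (\<And>w. dual_ball p (\<lambda>n. if n < N then \<phi> n w else 0)) \<Longrightarrow>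
    norm (\<Sum>n<N. blinfun_apply (T (\<phi> n)) (v n)) \<le> D * (\<Sum>n<(N::nat). norm (v n) powr p) powr (1/p)"
proof (cases "p = 1")
  case True
  show thesis
  proof (rule that[of "norm S + 1"])
    fix N :: nat and \<phi> :: "nat \<Rightarrow> 'w \<Rightarrow> 'k" and v
    assume "\<And>n. n < N \<Longrightarrow> continuous_on UNIV (\<phi> n)"
      "\<And>w. dual_ball p (\<lambda>n. if n < N then \<phi> n w else 0)"
    then have "norm (\<Sum>n<N. blinfun_apply (T (\<phi> n)) (v n)) \<le> norm S * (\<Sum>n<N. norm (v n) powr p) powr (1/p)"
      using tensor_bound_1[of N \<phi> v] unfolding True by blast
    also have "\<dots> \<le> (norm S + 1) * (\<Sum>n<N. norm (v n) powr p) powr (1/p)"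
      by (intro mult_right_mono) auto
    finally show "norm (\<Sum>n<N. blinfun_apply (T (\<phi> n)) (v n)) \<le> (norm S + 1) * (\<Sum>n<N. norm (v n) powr p) powr (1/p)" .
  qed (simp add: add_nonneg_pos)
next
  case False
  then have p1: "1 < p" using p by simp
  define r where "r = p / (p - 1)"
  have pq: "p < q / (q - 1)" using p(2) q by (simp add: conj_index_def one_ereal_def)
  have qr: "q < r" using pq p1 q by (simp add: r_def field_simps)
  obtain C where C: "\<And>n v. v \<in> {..<n} \<rightarrow> dual sx \<Longrightarrow>
      (\<Sum>i<n. norm (v i) powr q) powr (1 / q)
         \<le> C * sqrt ((\<Sum>e\<in>{..<n} \<rightarrow>\<^sub>E {-1, 1}. (norm (\<Sum>i<n. e i *\<^sub>R v i))\<^sup>2) / 2 ^ n)"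
    using cotype unfolding has_cotype_def by blast
  \<comment> \<open>The 2 is the norm bound of the norming functional; the 1 makes \<open>B\<close>
    positive even for S = 0.\<close>
  define B where "B = 2 * norm S + 1"
  define L where "L = 2 * 2 powr q * (\<bar>C\<bar> * B) powr q / slice_const B q r + 1"
  have B: "0 < B" by (simp add: B_def add_nonneg_pos)
  have L: "0 < L" unfolding L_def
    using slice_const_pos[OF B _ qr] q by (intro add_nonneg_pos divide_nonneg_nonneg) auto
  show thesis
  proof (rule that[of "L powr (1/r)"])
    show "0 < L powr (1/r)" using L by simp
    fix N :: nat and \<phi> :: "nat \<Rightarrow> 'w \<Rightarrow> 'k" and v
    assume \<phi>: "\<And>n. n < N \<Longrightarrow> continuous_on UNIV (\<phi> n)"
      and ball: "\<And>w. dual_ball p (\<lambda>n. if n < N then \<phi> n w else 0)"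
    let ?z = "\<Sum>n<N. blinfun_apply (T (\<phi> n)) (v n)"
    obtain y where y: "y \<in> dual sy" "norm y \<le> 2" "norm ?z \<le> norm (blinfun_apply y ?z)"
      by (rule Y.ex_norming_functional)
    interpret summing_seminorm "\<lambda>f. norm (y o\<^sub>L T f)" B "(\<bar>C\<bar> * B) powr q" q
      unfolding B_def by (rule summing_seminorm_functional_T[OF q C y(1,2)])
    have "(\<Sum>n<N. norm (\<phi> n w) powr r) \<le> 1" for w
      using ball[of w] unfolding dual_ball_iff_sum_powr[OF p1] r_def[symmetric] by (auto dest: spec[of _ N])
    then have sum_L: "(\<Sum>n<N. norm (y o\<^sub>L T (\<phi> n)) powr r) \<le> L"
      using r_summing[OF qr, of N \<phi>] \<phi> by (simp add: L_def)
    define \<alpha> where "\<alpha> n = (if n < N then norm (y o\<^sub>L T (\<phi> n)) / L powr (1/r) else 0)" for n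
    have r: "0 < r" using qr q by simp
    have \<alpha>_powr: "norm (\<alpha> n) powr r = (if n < N then norm (y o\<^sub>L T (\<phi> n)) powr r / L else 0)" for n
      using L r by (simp add: \<alpha>_def powr_divide powr_powr)
    have "dual_ball p \<alpha>"
      unfolding dual_ball_iff_sum_powr[OF p1] r_def[symmetric]
    proof
      fix M
      have "(\<Sum>n<M. norm (\<alpha> n) powr r) \<le> (\<Sum>n<max M N. norm (\<alpha> n) powr r)"
        by (intro sum_mono2) auto
      also have "\<dots> = (\<Sum>n<N. norm (\<alpha> n) powr r)"
        by (intro sum.mono_neutral_right) (auto simp: \<alpha>_def)
      also have "\<dots> = (\<Sum>n<N. norm (y o\<^sub>L T (\<phi> n)) powr r) / L"
        unfolding sum_divide_distrib by (intro sum.cong) (simp_all add: \<alpha>_powr del: real_norm_def)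
      also have "\<dots> \<le> 1" using sum_L L by simp
      finally show "(\<Sum>n<M. norm (\<alpha> n) powr r) \<le> 1" .
    qed
    then have "(\<Sum>n<N. norm (\<alpha> n) * norm (v n)) \<le> (\<Sum>n<N. norm (v n) powr p) powr (1/p)"
      using p by (intro dual_ball_holder) auto
    then have holder: "(\<Sum>n<N. norm (y o\<^sub>L T (\<phi> n)) / L powr (1/r) * norm (v n)) \<le> (\<Sum>n<N. norm (v n) powr p) powr (1/p)"
      by (simp add: \<alpha>_def)
    have "norm ?z \<le> norm (\<Sum>n<N. blinfun_apply (y o\<^sub>L T (\<phi> n)) (v n))"
      using y(3) by (simp add: blinfun.sum_right)
    also have "\<dots> \<le> (\<Sum>n<N. norm (y o\<^sub>L T (\<phi> n)) * norm (v n))"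
      by (intro sum_norm_le norm_blinfun)
    also have "\<dots> = L powr (1/r) * (\<Sum>n<N. norm (y o\<^sub>L T (\<phi> n)) / L powr (1/r) * norm (v n))"
      using L by (simp add: sum_distrib_left)
    also have "\<dots> \<le> L powr (1/r) * (\<Sum>n<N. norm (v n) powr p) powr (1/p)"
      using holder by (intro mult_left_mono) auto
    finally show "norm ?z \<le> L powr (1/r) * (\<Sum>n<N. norm (v n) powr p) powr (1/p)" .
  qed
qed

text \<open>The value that the operator sought must take at the sum of elementary tensors that
  approximates \<open>f\<close> by its samples.\<close>

definition riemann_sum :: "('w \<Rightarrow>\<^sub>C 'x) \<Rightarrow> 'w set \<times> ('w \<Rightarrow> 'w \<Rightarrow> real) \<Rightarrow> 'y"
  where "riemann_sum f P = (\<Sum>a\<in>fst P. blinfun_apply (T (\<lambda>w. of_real (snd P a w))) (apply_bcontfun f a))"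

lemma riemann_sum_add: "riemann_sum (f + g) P = riemann_sum f P + riemann_sum g P"
  by (simp add: riemann_sum_def blinfun.add_right sum.distrib)

lemma riemann_sum_scale: "riemann_sum (scale_bcontfun sx c f) P = sy c (riemann_sum f P)"
  by (simp add: riemann_sum_def X.scale_bcontfun_apply T_scale Y.scale_sum_right)

text \<open>For an elementary function the sum collapses to one value of \<open>T\<close> at a
  scalar function, which differs from \<open>\<phi>\<close> by \<open>\<psi>\<close>. Fineness
  refers to \<phi> x and not to \<phi>, so what is small is \<open>norm (\<psi> w) * norm x\<close>;
  hence the separate case x = 0.\<close>

lemma riemann_sum_elem_fun_tendsto:
  "(riemann_sum (elem_fun sx \<phi> x) \<longlongrightarrow> blinfun_apply (blinfun_apply S \<phi>) x) (fine_filter TYPE('w \<Rightarrow>\<^sub>C 'x))"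
proof (rule tendstoI)
  fix e :: real assume e: "0 < e"
  define \<delta> where "\<delta> = e / (norm S + 1)"
  have S1: "0 < norm S + 1" by (simp add: add_nonneg_pos)
  then have \<delta>: "0 < \<delta>" using e by (simp add: \<delta>_def)
  have "dist (riemann_sum (elem_fun sx \<phi> x) P) (blinfun_apply (blinfun_apply S \<phi>) x) < e"
    if P: "fine_partition (elem_fun sx \<phi> x) \<delta> P" for P
  proof -
    obtain A \<eta> where P_eq: "P = (A, \<eta>)" by (cases P)
    have A: "finite A" and \<eta>: "\<And>a. a \<in> A \<Longrightarrow> continuous_on UNIV (\<eta> a)" "\<And>a w. a \<in> A \<Longrightarrow> 0 \<le> \<eta> a w"
      "\<And>w. (\<Sum>a\<in>A. \<eta> a w) = 1"
      and fine: "\<And>a w. a \<in> A \<Longrightarrow> \<eta> a w \<noteq> 0 \<Longrightarrow> norm (sx (apply_bcontfun \<phi> w) x - sx (apply_bcontfun \<phi> a) x) < \<delta>"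
      using P by (auto simp: fine_partition_def P_eq X.elem_fun_apply)
    define \<psi> where "\<psi> w = (\<Sum>a\<in>A. apply_bcontfun \<phi> a * of_real (\<eta> a w)) - apply_bcontfun \<phi> w" for w
    have \<psi>_cont: "continuous_on UNIV \<psi>"
      unfolding \<psi>_def using \<eta>(1) by (auto intro!: continuous_intros)
    have \<psi>_le: "norm (\<psi> w) * norm x \<le> \<delta>" for w
    proof -
      have "apply_bcontfun \<phi> w = (\<Sum>a\<in>A. apply_bcontfun \<phi> w * of_real (\<eta> a w))"
        using \<eta>(3)[of w] by (simp flip: sum_distrib_left of_real_sum)
      then have "\<psi> w = (\<Sum>a\<in>A. of_real (\<eta> a w) * (apply_bcontfun \<phi> a - apply_bcontfun \<phi> w))"
        unfolding \<psi>_def by (simp add: algebra_simps sum_subtractf)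
      then have "norm (\<psi> w) \<le> (\<Sum>a\<in>A. \<eta> a w * norm (apply_bcontfun \<phi> a - apply_bcontfun \<phi> w))"
        using \<eta>(2) by (auto intro!: sum_norm_le simp: norm_mult)
      then have "norm (\<psi> w) * norm x \<le> (\<Sum>a\<in>A. \<eta> a w * norm (apply_bcontfun \<phi> a - apply_bcontfun \<phi> w)) * norm x"
        by (intro mult_right_mono) auto
      also have "\<dots> = (\<Sum>a\<in>A. \<eta> a w * norm (sx (apply_bcontfun \<phi> w) x - sx (apply_bcontfun \<phi> a) x))"
        by (simp add: sum_distrib_right mult.assoc X.norm_scale norm_minus_commute[of "apply_bcontfun \<phi> w"]
            flip: X.scale_left_diff_distrib)
      also have "\<dots> \<le> (\<Sum>a\<in>A. \<eta> a w * \<delta>)"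
        using fine \<eta>(2) by (intro sum_mono) (metis less_imp_le mult_left_mono mult_zero_left)
      also have "\<dots> = \<delta>" using \<eta>(3)[of w] by (simp flip: sum_distrib_right)
      finally show ?thesis .
    qed
    have "riemann_sum (elem_fun sx \<phi> x) P = (\<Sum>a\<in>A. blinfun_apply (T (\<lambda>w. apply_bcontfun \<phi> a * of_real (\<eta> a w))) x)"
      unfolding riemann_sum_def P_eq fst_conv snd_conv
    proof (intro sum.cong refl)
      fix a assume "a \<in> A"
      then have "continuous_on UNIV (\<lambda>w. of_real (\<eta> a w) :: 'k)" using \<eta>(1) by (intro continuous_intros) auto
      then show "blinfun_apply (T (\<lambda>w. of_real (\<eta> a w))) (apply_bcontfun (elem_fun sx \<phi> x) a)
          = blinfun_apply (T (\<lambda>w. apply_bcontfun \<phi> a * of_real (\<eta> a w))) x"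
        by (simp add: X.elem_fun_apply T_scale T_mult_const)
    qed
    also have "\<dots> = blinfun_apply (T (\<lambda>w. \<Sum>a\<in>A. apply_bcontfun \<phi> a * of_real (\<eta> a w))) x"
      using A \<eta>(1) by (subst T_sum) (auto simp: blinfun.sum_left intro!: continuous_intros)
    also have "(\<lambda>w. \<Sum>a\<in>A. apply_bcontfun \<phi> a * of_real (\<eta> a w)) = (\<lambda>w. \<psi> w + apply_bcontfun \<phi> w)"
      by (simp add: \<psi>_def)
    also have "T (\<lambda>w. \<psi> w + apply_bcontfun \<phi> w) = T \<psi> + blinfun_apply S \<phi>"
      by (subst T_add) (auto simp: \<psi>_cont T_apply_bcontfun)
    finally have "dist (riemann_sum (elem_fun sx \<phi> x) P) (blinfun_apply (blinfun_apply S \<phi>) x) = norm (blinfun_apply (T \<psi>) x)"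
      by (simp add: dist_norm blinfun.add_left)
    also have "\<dots> \<le> norm S * \<delta>"
    proof (cases "x = 0")
      case False
      have "norm (T \<psi>) \<le> norm S * (\<delta> / norm x)"
        using \<psi>_le False by (intro norm_T_le \<psi>_cont) (simp add: field_simps)
      then have "norm (T \<psi>) * norm x \<le> norm S * \<delta>" using False by (simp add: field_simps)
      then show ?thesis using norm_blinfun order_trans by blast
    qed (use \<delta> in simp)
    also have "\<dots> < e" using e S1 by (simp add: \<delta>_def field_simps)
    finally show ?thesis .
  qed
  then show "\<forall>\<^sub>F P in (fine_filter TYPE('w \<Rightarrow>\<^sub>C 'x)). dist (riemann_sum (elem_fun sx \<phi> x) P) (blinfun_apply (blinfun_apply S \<phi>) x) < e"
    by (rule eventually_mono[OF eventually_fine_partition[OF \<delta>], rotated])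
qed

end

section \<open>Convergence of the Riemann sums and the operator U\<close>

locale tensor_bounded = operator_on_C sx sy S
  for sx :: "'k::rc_field \<Rightarrow> 'x::banach \<Rightarrow> 'x" and sy :: "'k \<Rightarrow> 'y::banach \<Rightarrow> 'y"
    and S :: "('w::t2_space \<Rightarrow>\<^sub>C 'k) \<Rightarrow>\<^sub>L ('x \<Rightarrow>\<^sub>L 'y)" +
  fixes p D :: real
  assumes p: "1 \<le> p" and D: "0 < D"
    and tensor_le: "\<And>N \<phi> v. (\<And>n. n < N \<Longrightarrow> continuous_on UNIV (\<phi> n)) \<Longrightarrow>
      (\<And>w. dual_ball p (\<lambda>n. if n < N then \<phi> n w else 0)) \<Longrightarrow>
      norm (\<Sum>n<N. blinfun_apply (T (\<phi> n)) (v n)) \<le> D * (\<Sum>n<(N::nat). norm (v n) powr p) powr (1/p)"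
begin

text \<open>Expanding each \<open>y k\<close> in \<open>v\<close> and exchanging the sums gives a
  series of terms \<open>T (\<phi> n)\<close> applied to \<open>v n\<close>. At every point
  \<open>w\<close> the coefficients \<open>\<phi> n w\<close> combine elements of the dual ball with
  weights \<open>\<eta> k w\<close> of sum at most 1, so the tensor bound applies to each partial
  sum.\<close>

lemma hull_sum_bound:
  assumes I: "finite I" and \<eta>: "\<And>k. k \<in> I \<Longrightarrow> continuous_on UNIV (\<eta> k)" "\<And>k w. k \<in> I \<Longrightarrow> 0 \<le> \<eta> k w"
    "\<And>w. (\<Sum>k\<in>I. \<eta> k w) \<le> 1"
    and y: "\<And>k. k \<in> I \<Longrightarrow> y k \<in> p_hull p sx v" and v: "v \<in> lp_space (ereal p)"
  shows "norm (\<Sum>k\<in>I. blinfun_apply (T (\<lambda>w. of_real (\<eta> k w))) (y k)) \<le> D * lp_norm (ereal p) v"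
proof -
  have "\<forall>k\<in>I. \<exists>\<alpha>. dual_ball p \<alpha> \<and> (\<lambda>n. sx (\<alpha> n) (v n)) sums y k"
    using y p_hull_iff[OF p] by blast
  then obtain \<alpha> where \<alpha>: "\<And>k. k \<in> I \<Longrightarrow> dual_ball p (\<alpha> k)"
    "\<And>k. k \<in> I \<Longrightarrow> (\<lambda>n. sx (\<alpha> k n) (v n)) sums y k" by metis
  define \<phi> where "\<phi> n w = (\<Sum>k\<in>I. \<alpha> k n * of_real (\<eta> k w))" for n w
  have \<eta>_cont: "continuous_on UNIV (\<lambda>w. of_real (\<eta> k w) :: 'k)" if "k \<in> I" for k
    using \<eta>(1)[OF that] by (intro continuous_intros)
  have \<phi>_cont: "continuous_on UNIV (\<phi> n)" for n
    unfolding \<phi>_def using \<eta>_cont by (auto intro!: continuous_on_sum continuous_on_mult_left)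
  have ball: "dual_ball p (\<lambda>n. if n < N then \<phi> n w else 0)" for N w
  proof (rule dual_ball_combination[of I "\<lambda>k. \<eta> k w" p \<alpha>])
    fix n
    have "norm (\<phi> n w) \<le> (\<Sum>k\<in>I. \<eta> k w * norm (\<alpha> k n))"
      unfolding \<phi>_def using \<eta>(2) by (intro sum_norm_le) (simp add: norm_mult)
    moreover have "0 \<le> (\<Sum>k\<in>I. \<eta> k w * norm (\<alpha> k n))" using \<eta>(2) by (intro sum_nonneg) auto
    ultimately show "norm (if n < N then \<phi> n w else 0) \<le> (\<Sum>k\<in>I. \<eta> k w * norm (\<alpha> k n))" by simp
  qed (use \<eta> \<alpha> in auto)
  have summable: "summable (\<lambda>n. norm (v n) powr p)" using v by (simp add: lp_space_def)
  have partial: "norm (\<Sum>k\<in>I. blinfun_apply (T (\<lambda>w. of_real (\<eta> k w))) (\<Sum>n<N. sx (\<alpha> k n) (v n))) \<le> D * lp_norm (ereal p) v" for N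
  proof -
    have "blinfun_apply (T (\<phi> n)) (v n) = (\<Sum>k\<in>I. blinfun_apply (T (\<lambda>w. of_real (\<eta> k w))) (sx (\<alpha> k n) (v n)))" for n
      unfolding \<phi>_def using I \<eta>_cont
      by (subst T_sum) (auto simp: blinfun.sum_left T_scale T_mult_const intro!: continuous_on_mult_left)
    then have eq: "(\<Sum>n<N. blinfun_apply (T (\<phi> n)) (v n)) =
        (\<Sum>k\<in>I. blinfun_apply (T (\<lambda>w. of_real (\<eta> k w))) (\<Sum>n<N. sx (\<alpha> k n) (v n)))"
      by (simp add: blinfun.sum_right) (rule sum.swap)
    have "norm (\<Sum>n<N. blinfun_apply (T (\<phi> n)) (v n)) \<le> D * (\<Sum>n<N. norm (v n) powr p) powr (1/p)"
      by (rule tensor_le[OF \<phi>_cont ball])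
    also have "(\<Sum>n<N. norm (v n) powr p) powr (1/p) \<le> lp_norm (ereal p) v"
      unfolding lp_norm_def using p summable by (auto intro!: powr_mono2 sum_le_suminf sum_nonneg)
    finally show ?thesis using D by (simp add: eq)
  qed
  have "(\<lambda>N. norm (\<Sum>k\<in>I. blinfun_apply (T (\<lambda>w. of_real (\<eta> k w))) (\<Sum>n<N. sx (\<alpha> k n) (v n))))
      \<longlonglongrightarrow> norm (\<Sum>k\<in>I. blinfun_apply (T (\<lambda>w. of_real (\<eta> k w))) (y k))"
    using \<alpha>(2) unfolding sums_def by (intro tendsto_intros) auto
  then show ?thesis by (rule LIMSEQ_le_const2) (use partial in blast)
qed

lemma riemann_sum_bound:
  assumes "fine_partition f \<delta> P" "v \<in> lp_space (ereal p)" "range (apply_bcontfun f) \<subseteq> p_hull p sx v"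
  shows "norm (riemann_sum f P) \<le> D * lp_norm (ereal p) v"
  unfolding riemann_sum_def
  by (rule hull_sum_bound) (use assms in \<open>auto simp: fine_partition_def\<close>)

text \<open>Both sums are written over the common refinement by the products of partition functions.
  Where such a product is nonzero, the two sample values are close, so their difference lies in the
  hull of a small sequence and \<open>hull_sum_bound\<close> applies.\<close>

lemma riemann_sum_Cauchy:
  assumes f: "f \<in> Cp_space p sx" and e: "0 < e"
  obtains \<delta> where "0 < \<delta>" "\<And>P Q. fine_partition f \<delta> P \<Longrightarrow> fine_partition f \<delta> Q \<Longrightarrow>
    dist (riemann_sum f P) (riemann_sum f Q) < e"
proof -
  obtain x where x: "x \<in> lp_space (ereal p)" "range (apply_bcontfun f) \<subseteq> p_hull p sx x"
    using f by (auto simp: Cp_space_def)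
  \<comment> \<open>The division by \<open>D\<close> cancels the constant of
    \<open>hull_sum_bound\<close>; the 2 makes the final inequality strict.\<close>
  have "0 < e / (2 * D)" using e D by simp
  from X.p_hull_small_difference[OF p x(1) this] obtain \<delta> v where \<delta>: "0 < \<delta>" and v: "v \<in> lp_space (ereal p)"
    "lp_norm (ereal p) v \<le> e / (2 * D)"
    and diff: "\<And>y y'. y \<in> p_hull p sx x \<Longrightarrow> y' \<in> p_hull p sx x \<Longrightarrow> norm (y - y') < \<delta> \<Longrightarrow> y - y' \<in> p_hull p sx v"
    by blast
  have zero: "0 \<in> p_hull p sx v"
    using p by (auto simp: p_hull_iff intro!: exI[of _ "\<lambda>n. 0"])
  show thesis
  proof (rule that[of "\<delta> / 2"])
    show "0 < \<delta> / 2" using \<delta> by simp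
    fix P Q assume PQ: "fine_partition f (\<delta> / 2) P" "fine_partition f (\<delta> / 2) Q"
    obtain A \<eta> where P_eq: "P = (A, \<eta>)" by (cases P)
    obtain B \<theta> where Q_eq: "Q = (B, \<theta>)" by (cases Q)
    have A: "finite A" and \<eta>: "\<And>a. a \<in> A \<Longrightarrow> continuous_on UNIV (\<eta> a)" "\<And>a w. a \<in> A \<Longrightarrow> 0 \<le> \<eta> a w"
      "\<And>w. (\<Sum>a\<in>A. \<eta> a w) = 1"
      and fineA: "\<And>a w. a \<in> A \<Longrightarrow> \<eta> a w \<noteq> 0 \<Longrightarrow> norm (apply_bcontfun f w - apply_bcontfun f a) < \<delta> / 2"
      using PQ(1) by (auto simp: fine_partition_def P_eq)
    have B: "finite B" and \<theta>: "\<And>a. a \<in> B \<Longrightarrow> continuous_on UNIV (\<theta> a)" "\<And>a w. a \<in> B \<Longrightarrow> 0 \<le> \<theta> a w"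
      "\<And>w. (\<Sum>a\<in>B. \<theta> a w) = 1"
      and fineB: "\<And>a w. a \<in> B \<Longrightarrow> \<theta> a w \<noteq> 0 \<Longrightarrow> norm (apply_bcontfun f w - apply_bcontfun f a) < \<delta> / 2"
      using PQ(2) by (auto simp: fine_partition_def Q_eq)
    let ?h = "\<lambda>k w. \<eta> (fst k) w * \<theta> (snd k) w"
    let ?f = "apply_bcontfun f"
    have h_cont: "continuous_on UNIV (?h k)" "continuous_on UNIV (\<lambda>w. of_real (?h k w) :: 'k)" if "k \<in> A \<times> B" for k
      using that \<eta>(1) \<theta>(1) by (auto intro!: continuous_intros)
    have left: "T (\<lambda>w. of_real (\<eta> a w)) = (\<Sum>b\<in>B. T (\<lambda>w. of_real (?h (a, b) w)))" if "a \<in> A" for a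
    proof -
      have "of_real (\<eta> a w) = (\<Sum>b\<in>B. of_real (?h (a, b) w) :: 'k)" for w
        using \<theta>(3)[of w] by (simp flip: sum_distrib_left of_real_sum)
      then show ?thesis using B h_cont that by (subst T_sum[symmetric]) auto
    qed
    have right: "T (\<lambda>w. of_real (\<theta> b w)) = (\<Sum>a\<in>A. T (\<lambda>w. of_real (?h (a, b) w)))" if "b \<in> B" for b
    proof -
      have "of_real (\<theta> b w) = (\<Sum>a\<in>A. of_real (?h (a, b) w) :: 'k)" for w
        using \<eta>(3)[of w] by (simp flip: sum_distrib_right of_real_sum)
      then show ?thesis using A h_cont that by (subst T_sum[symmetric]) auto
    qed
    \<comment> \<open>If a product vanishes identically, its two sample values may be far apart.
      Replacing their difference by 0 is harmless, because the operator in front of it is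
      \<open>T\<close> at the zero function.\<close>
    define y where "y k = (if \<exists>w. ?h k w \<noteq> 0 then ?f (fst k) - ?f (snd k) else 0)" for k
    have y: "y k \<in> p_hull p sx v" if k: "k \<in> A \<times> B" for k
    proof (cases "\<exists>w. ?h k w \<noteq> 0")
      case True
      then obtain w where "\<eta> (fst k) w \<noteq> 0" "\<theta> (snd k) w \<noteq> 0" by auto
      then have "norm (?f w - ?f (fst k)) < \<delta> / 2" "norm (?f w - ?f (snd k)) < \<delta> / 2"
        using k fineA fineB by auto
      then have "norm (?f (fst k) - ?f (snd k)) < \<delta>"
        using norm_triangle_ineq4[of "?f w - ?f (snd k)" "?f w - ?f (fst k)"] by simp
      moreover have "?f (fst k) \<in> p_hull p sx x" "?f (snd k) \<in> p_hull p sx x" using x(2) by auto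
      ultimately show ?thesis using True diff by (simp add: y_def)
    qed (simp add: y_def zero)
    have "riemann_sum f P = (\<Sum>a\<in>A. \<Sum>b\<in>B. blinfun_apply (T (\<lambda>w. of_real (?h (a, b) w))) (?f a))"
      unfolding riemann_sum_def P_eq by (simp add: left blinfun.sum_left)
    moreover have "riemann_sum f Q = (\<Sum>a\<in>A. \<Sum>b\<in>B. blinfun_apply (T (\<lambda>w. of_real (?h (a, b) w))) (?f b))"
      unfolding riemann_sum_def Q_eq by (simp add: right blinfun.sum_left) (rule sum.swap)
    ultimately have "riemann_sum f P - riemann_sum f Q =
        (\<Sum>a\<in>A. \<Sum>b\<in>B. blinfun_apply (T (\<lambda>w. of_real (?h (a, b) w))) (?f a - ?f b))"
      by (simp add: blinfun.diff_right sum_subtractf)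
    also have "\<dots> = (\<Sum>k\<in>A \<times> B. blinfun_apply (T (\<lambda>w. of_real (?h k w))) (?f (fst k) - ?f (snd k)))"
      by (simp add: sum.cartesian_product case_prod_beta)
    also have "\<dots> = (\<Sum>k\<in>A \<times> B. blinfun_apply (T (\<lambda>w. of_real (?h k w))) (y k))"
    proof (intro sum.cong refl)
      fix k
      show "blinfun_apply (T (\<lambda>w. of_real (?h k w))) (?f (fst k) - ?f (snd k)) = blinfun_apply (T (\<lambda>w. of_real (?h k w))) (y k)"
      proof (cases "\<exists>w. ?h k w \<noteq> 0")
        case False
        then have "(\<lambda>w. of_real (?h k w) :: 'k) = (\<lambda>w. 0)" by auto
        then show ?thesis by (simp only: T_zero) simp
      qed (simp add: y_def)
    qed
    finally have "riemann_sum f P - riemann_sum f Q = (\<Sum>k\<in>A \<times> B. blinfun_apply (T (\<lambda>w. of_real (?h k w))) (y k))" .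
    moreover have "norm (\<Sum>k\<in>A \<times> B. blinfun_apply (T (\<lambda>w. of_real (?h k w))) (y k)) \<le> D * lp_norm (ereal p) v"
    proof (rule hull_sum_bound)
      fix w
      have "(\<Sum>k\<in>A \<times> B. ?h k w) = (\<Sum>a\<in>A. \<eta> a w) * (\<Sum>b\<in>B. \<theta> b w)"
        by (simp add: sum_product sum.cartesian_product case_prod_beta)
      then show "(\<Sum>k\<in>A \<times> B. ?h k w) \<le> 1" by (simp add: \<eta> \<theta>)
    qed (use A B y v h_cont \<eta> \<theta> in auto)
    moreover have "D * lp_norm (ereal p) v \<le> D * (e / (2 * D))" using v D by (intro mult_left_mono) auto
    moreover have "D * (e / (2 * D)) < e" using D e by simp
    ultimately show "dist (riemann_sum f P) (riemann_sum f Q) < e" by (simp add: dist_norm)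
  qed
qed

lemma riemann_sum_convergent:
  assumes "f \<in> Cp_space p sx"
  shows "\<exists>l. (riemann_sum f \<longlongrightarrow> l) (fine_filter TYPE('w \<Rightarrow>\<^sub>C 'x))"
proof -
  have "cauchy_filter (filtermap (riemann_sum f) (fine_filter TYPE('w \<Rightarrow>\<^sub>C 'x)))"
    unfolding cauchy_filter_metric_filtermap
    by (metis riemann_sum_Cauchy[OF assms] eventually_fine_partition)
  moreover have "filtermap (riemann_sum f) (fine_filter TYPE('w \<Rightarrow>\<^sub>C 'x)) \<noteq> bot"
    using fine_filter_neq_bot[OF compact_domain] by (simp add: filtermap_bot_iff)
  moreover have "complete (UNIV :: 'y set)" by (rule complete_UNIV)
  ultimately show ?thesis
    unfolding complete_uniform filterlim_def by auto
qed

text \<open>\<open>Lim\<close> is total, so the values outside C_p may be arbitrary;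
  \<open>Cp_operators\<close> constrains only those on C_p.\<close>

definition U :: "('w \<Rightarrow>\<^sub>C 'x) \<Rightarrow> 'y"
  where "U f = Lim (fine_filter TYPE('w \<Rightarrow>\<^sub>C 'x)) (riemann_sum f)"

lemma U_eqI: "(riemann_sum f \<longlongrightarrow> l) (fine_filter TYPE('w \<Rightarrow>\<^sub>C 'x)) \<Longrightarrow> U f = l"
  unfolding U_def by (rule tendsto_Lim) (rule fine_filter_neq_bot[OF compact_domain])

lemma riemann_sum_tendsto_U: "f \<in> Cp_space p sx \<Longrightarrow> (riemann_sum f \<longlongrightarrow> U f) (fine_filter TYPE('w \<Rightarrow>\<^sub>C 'x))"
  using riemann_sum_convergent U_eqI by blast

lemma norm_U_le:
  assumes "f \<in> Cp_space p sx"
  shows "norm (U f) \<le> D * Cp_norm p sx f"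
proof -
  have "norm (U f) / D \<le> lp_norm (ereal p) x"
    if x: "x \<in> lp_space (ereal p)" "range (apply_bcontfun f) \<subseteq> p_hull p sx x" for x
  proof -
    have "norm (U f) \<le> D * lp_norm (ereal p) x"
    proof (rule tendsto_upperbound[OF tendsto_norm[OF riemann_sum_tendsto_U[OF assms]]])
      show "\<forall>\<^sub>F P in (fine_filter TYPE('w \<Rightarrow>\<^sub>C 'x)). norm (riemann_sum f P) \<le> D * lp_norm (ereal p) x"
        \<comment> \<open>The fineness 1 is an arbitrary choice: \<open>riemann_sum_bound\<close>
          has the same constant for every fineness.\<close>
        by (rule eventually_mono[OF eventually_fine_partition[of 1 f]]) (auto intro: riemann_sum_bound[OF _ x])
    qed (rule fine_filter_neq_bot[OF compact_domain])
    then show ?thesis using D by (simp add: field_simps)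
  qed
  then have "norm (U f) / D \<le> Cp_norm p sx f"
    unfolding Cp_norm_def using assms by (intro cInf_greatest) (auto simp: Cp_space_def)
  then show ?thesis using D by (simp add: field_simps)
qed

lemma U_in_Cp_operators: "U \<in> Cp_operators p sx sy"
  unfolding Cp_operators_def
proof (intro CollectI conjI ballI allI exI[of _ D] norm_U_le)
  fix f g :: "'w \<Rightarrow>\<^sub>C 'x"
  assume fg: "f \<in> Cp_space p sx" "g \<in> Cp_space p sx"
  show "U (f + g) = U f + U g"
    using tendsto_add[OF fg[THEN riemann_sum_tendsto_U]] by (intro U_eqI) (simp add: riemann_sum_add[abs_def])
next
  fix c and f :: "'w \<Rightarrow>\<^sub>C 'x"
  assume f: "f \<in> Cp_space p sx"
  show "U (scale_bcontfun sx c f) = sy c (U f)"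
    using bounded_linear.tendsto[OF bounded_bilinear.bounded_linear_right[OF Y.bounded_bilinear_scale]
        riemann_sum_tendsto_U[OF f]]
    by (intro U_eqI) (simp add: riemann_sum_scale[abs_def])
qed

lemma assoc_op_U: "assoc_op sx U = (\<lambda>\<phi>. blinfun_apply (blinfun_apply S \<phi>))"
  unfolding assoc_op_def by (intro ext U_eqI riemann_sum_elem_fun_tendsto)

end

theorem corollary2p7:
  fixes sx :: "'k::rc_field \<Rightarrow> 'x::banach \<Rightarrow> 'x"
    and sy :: "'k \<Rightarrow> 'y::banach \<Rightarrow> 'y"
    and S :: "('w::t2_space \<Rightarrow>\<^sub>C 'k) \<Rightarrow>\<^sub>L ('x \<Rightarrow>\<^sub>L 'y)"
    and q :: real
  assumes "normed_space_over sx" and "normed_space_over sy"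
    and "2 \<le> q" and "has_cotype (dual sx) q"
    and "compact (UNIV :: 'w set)"
    and "S \<in> operators (scale_bcontfun (*)) (scale_blinfun sy)"
    and "range (blinfun_apply S) \<subseteq> operators sx sy"
  shows "\<forall>p::real. 1 \<le> p \<and> ereal p < conj_index (ereal q) \<longrightarrow>
           (\<exists>U \<in> Cp_operators p sx sy. assoc_op sx U = (\<lambda>\<phi>. blinfun_apply (blinfun_apply S \<phi>)))"
proof (intro allI impI)
  fix p :: real assume p: "1 \<le> p \<and> ereal p < conj_index (ereal q)"
  interpret operator_on_C sx sy S
    using assms by (intro operator_on_C.intro operator_on_C_axioms.intro)
  obtain D where D: "0 < D" "\<And>N \<phi> v. (\<And>n. n < N \<Longrightarrow> continuous_on UNIV (\<phi> n)) \<Longrightarrow>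
      (\<And>w. dual_ball p (\<lambda>n. if n < N then \<phi> n w else 0)) \<Longrightarrow>
      norm (\<Sum>n<N. blinfun_apply (T (\<phi> n)) (v n)) \<le> D * (\<Sum>n<(N::nat). norm (v n) powr p) powr (1/p)"
    using tensor_bound[OF assms(3,4)] p by blast
  interpret tensor_bounded sx sy S p D
    using p D by unfold_locales auto
  show "\<exists>U \<in> Cp_operators p sx sy. assoc_op sx U = (\<lambda>\<phi>. blinfun_apply (blinfun_apply S \<phi>))"
    using U_in_Cp_operators assoc_op_U by blast
qed

end
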